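(* Let $V^{n-1}$ be a smooth hypersurface of the conformal space $C^n$, let $a_{ij}$, $a^i_j$ and $a_{ijk}$ be its associated tensors (as defined in the context), and assume that $a_{ij}$ is nondegenerate, so that $a_{ijk}$ is defined. Suppose that $s_1$ is a simple eigenvalue of the affinor $a^i_j$ of $V^{n-1}$ (at each point of $V^{n-1}$), and that $V^{n-1}$ is referred to a conformal frame whose hypersphere $A_1$ is orthogonal to the corresponding eigendirection of this affinor and whose hyperspheres $A_p$, $p\neq 1$, are tangent to this direction. Then $V^{n-1}$ is a $1$-canal hypersurface for this eigendirection if and only if, in this frame, the diagonal component $a_{111}$ of the tensor $a_{ijk}$ vanishes (on $V^{n-1}$).
   Context: **Conformal space.** Everything is real and smooth, local, and $n\ge 3$. The $n$-dimensional conformal space $C^n$ is described by polyspherical coordinates: points and hyperspheres of $C^n$ are represented (up to a scalar factor) by nonzero vectors $X$ of an $(n+2)$-dimensional real vector space with a symmetric bilinear form $(\cdot,\cdot)$ of signature $(n+1,1)$. Here $(X,X)=0$ if $X$ is a point and $(X,X)>0$ if $X$ is a hypersphere; a point $X$ lies on a hypersphere $Y$ iff $(X,Y)=0$; two hyperspheres $X,Y$ are orthogonal iff $(X,Y)=0$. **Frames.** Indices: $i,j,k,l=1,\dots,n-1$ and $\xi,\eta=0,1,\dots,n+1$; summation over repeated indices is understood. With each point $x\in V^{n-1}$ one associates conformal frames $\{A_0,A_1,\dots,A_{n+1}\}$ in which $A_0=x$ and $A_{n+1}$ are points, and $A_1,\dots,A_{n-1},A_n$ are hyperspheres through both $A_0$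 and $A_{n+1}$; $A_n$ is tangent to $V^{n-1}$ at $x$, the $A_i$ are orthogonal to $V^{n-1}$ at $x$, and $$(A_0,A_0)=(A_{n+1},A_{n+1})=0,\quad (A_0,A_i)=(A_0,A_n)=(A_{n+1},A_i)=(A_{n+1},A_n)=0,$$ $$(A_i,A_n)=0,\quad (A_i,A_j)=g_{ij},\quad (A_n,A_n)=1,\quad (A_0,A_{n+1})=-1,$$ with $(g_{ij})$ positive definite. Write $dA_\xi=\omega_\xi^\eta A_\eta$. Then $\omega_0^{n+1}=0$, $\omega_0^n=0$, and $\omega^i:=\omega_0^i$ are basis forms on $V^{n-1}$, so $dA_0=\omega_0^0A_0+\omega^iA_i$. **Tensors.** The following equations define the symmetric $\lambda_{ij}$ and the totally symmetric $\lambda_{ijk}$: $$\omega_i^n=\lambda_{ij}\omega^j,\qquad d\lambda_{ij}-\lambda_{kj}\omega_i^k-\lambda_{ik}\omega_j^k+\lambda_{ij}\omega_0^0+g_{ij}\omega_n^0=\lambda_{ijk}\omega^k .$$ Let $(g^{ij})$ be the inverse of $(g_{ij})$ and put $$\lambda=\tfrac1{n-1}g^{ij}\lambda_{ij},\qquad a_{ij}=\lambda_{ij}-\lambda g_{ij},\qquad a^i_j=g^{ik}a_{kj}.$$ The symmetric affinor $a^i_j$ is called the affinor of Burali-Forti; its eigendirections in $T_xV^{n-1}$ are the principal directions of $V^{n-1}$. If $\det(a_{ij})\neq0$, let $(a^{ij})$ be the inverse of $(a_{ij})$ and put $$\lambda_k=\tfrac1{n-1}g^{ij}\lambda_{ijk},\qquad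 \mu^i=a^{ij}\lambda_j,\qquad a_{ijk}=\lambda_{ijk}+3\bigl(a_{(ij}g_{k)l}-g_{(ij}a_{k)l}\bigr)\mu^l,$$ where parentheses denote symmetrization over $i,j,k$, e.g. $3a_{(ij}g_{k)l}=a_{ij}g_{kl}+a_{jk}g_{il}+a_{ki}g_{jl}$. **Adapted frame.** The condition that $A_1$ is orthogonal to the eigendirection for $s_1$ and the $A_p$ ($p=2,\dots,n-1$) are tangent to it means that this eigendirection is given by $\omega^p=0$, $p=2,\dots,n-1$, and that $g_{1p}=0$; consequently also $a_{1p}=0$. **Canal hypersurfaces.** $V^{n-1}$ is a $1$-canal hypersurface if it is the envelope of an $(n-2)$-parameter family of hyperspheres; it then carries an $(n-2)$-parameter family of one-dimensional spherical characteristics (circles $S^1$) along which the hyperspheres of the family are tangent to $V^{n-1}$. It is a $1$-canal hypersurface for a given field of principal directions if these characteristic circles are tangent to that field at each point. *)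

theory Defs
  imports "HOL-Analysis.Analysis" "HOL-Computational_Algebra.Polynomial"
begin

section \<open>Smooth maps\<close>

text \<open>Meant for open \<open>S\<close>: all iterated directional derivatives up to order \<open>k\<close> exist, are
  differentiable below order \<open>k\<close>, and are continuous.\<close>

primrec Ck_on :: "nat \<Rightarrow> 'a::real_normed_vector set \<Rightarrow> ('a \<Rightarrow> 'b::real_normed_vector) \<Rightarrow> bool" where
  "Ck_on 0 S f \<longleftrightarrow> continuous_on S f"
| "Ck_on (Suc k) S f \<longleftrightarrow>
     (\<forall>x\<in>S. f differentiable (at x)) \<and> (\<forall>v. Ck_on k S (\<lambda>x. frechet_derivative f (at x) v))"

definition smooth_map_on :: "'a::real_normed_vector set \<Rightarrow> ('a \<Rightarrow> 'b::real_normed_vector) \<Rightarrow> bool" where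
  "smooth_map_on S f \<longleftrightarrow> (\<forall>k. Ck_on k S f)"

abbreviation deriv_along :: "('a::real_normed_vector \<Rightarrow> 'b::real_normed_vector) \<Rightarrow> 'a \<Rightarrow> 'a \<Rightarrow> 'b" where
  "deriv_along f u h \<equiv> frechet_derivative f (at u) h"


section \<open>Conformal space\<close>

definition positive_definite_on :: "('v::real_vector \<Rightarrow> 'v \<Rightarrow> real) \<Rightarrow> 'v set \<Rightarrow> bool" where
  "positive_definite_on B S \<longleftrightarrow> (\<forall>X\<in>S. X \<noteq> 0 \<longrightarrow> B X X > 0)"

text \<open>The inner product of the class \<open>euclidean_space\<close> plays no role: the class only says that
  the vector space is finite-dimensional, with its usual topology.\<close>

definition has_signature :: "('v::euclidean_space \<Rightarrow> 'v \<Rightarrow> real) \<Rightarrow> nat \<Rightarrow> nat \<Rightarrow> bool" where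
  "has_signature B p q \<longleftrightarrow>
     bilinear B \<and> (\<forall>X Y. B X Y = B Y X) \<and> p + q = DIM('v) \<and>
     (\<exists>P N. subspace P \<and> subspace N \<and> dim P = p \<and> dim N = q \<and>
        (\<forall>X\<in>P. \<forall>Y\<in>N. B X Y = 0) \<and>
        positive_definite_on B P \<and> positive_definite_on (\<lambda>X Y. - B X Y) N)"

definition is_point :: "('v::real_vector \<Rightarrow> 'v \<Rightarrow> real) \<Rightarrow> 'v \<Rightarrow> bool" where
  "is_point B X \<longleftrightarrow> X \<noteq> 0 \<and> B X X = 0"

definition is_hypersphere :: "('v::real_vector \<Rightarrow> 'v \<Rightarrow> real) \<Rightarrow> 'v \<Rightarrow> bool" where
  "is_hypersphere B X \<longleftrightarrow> B X X > 0"

text \<open>A hypersurface is given locally, by a smooth representative \<open>x\<close> of its points over an open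
  parameter domain \<open>U\<close>.  The last condition says that the induced map into the projective quadric
  of points is an immersion.\<close>

definition hypersurface ::
  "('v::euclidean_space \<Rightarrow> 'v \<Rightarrow> real) \<Rightarrow> (real^'i) set \<Rightarrow> (real^'i \<Rightarrow> 'v) \<Rightarrow> bool" where
  "hypersurface B U x \<longleftrightarrow> open U \<and> smooth_map_on U x \<and>
     (\<forall>u\<in>U. is_point B (x u) \<and> (\<forall>h c. deriv_along x u h = c *\<^sub>R x u \<longrightarrow> h = 0))"

text \<open>The hypersphere \<open>Y\<close> passes through \<open>x u\<close> and is tangent there to the direction \<open>h\<close>.\<close>

definition tangent_to_direction ::
  "('v::real_normed_vector \<Rightarrow> 'v \<Rightarrow> real) \<Rightarrow> ('e::real_normed_vector \<Rightarrow> 'v) \<Rightarrow> 'e \<Rightarrow> 'e \<Rightarrow> 'v \<Rightarrow> bool" where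
  "tangent_to_direction B x u h Y \<longleftrightarrow> B (x u) Y = 0 \<and> B (deriv_along x u h) Y = 0"


section \<open>Conformal frames and connection forms\<close>

text \<open>\<open>Ix0\<close>, \<open>Ix i\<close>, \<open>IxN\<close>, \<open>IxN1\<close> stand for the frame indices \<open>0\<close>, \<open>i\<close> (with \<open>1 \<le> i \<le> n - 1\<close>),
  \<open>n\<close> and \<open>n + 1\<close>.\<close>

datatype 'i frame_index = Ix0 | Ix 'i | IxN | IxN1

type_synonym ('i, 'v) frame_field = "'i frame_index \<Rightarrow> real^'i \<Rightarrow> 'v"

definition metric :: "('v \<Rightarrow> 'v \<Rightarrow> real) \<Rightarrow> ('i::finite, 'v) frame_field \<Rightarrow> real^'i \<Rightarrow> real^'i^'i" where
  "metric B A u = (\<chi> i j. B (A (Ix i) u) (A (Ix j) u))"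

definition conformal_frame ::
  "('v::euclidean_space \<Rightarrow> 'v \<Rightarrow> real) \<Rightarrow> (real^'i::finite) set \<Rightarrow> (real^'i \<Rightarrow> 'v) \<Rightarrow> ('i, 'v) frame_field \<Rightarrow> bool"
  where
  "conformal_frame B U x A \<longleftrightarrow>
     (\<forall>\<xi>. smooth_map_on U (A \<xi>)) \<and>
     (\<forall>u\<in>U.
        A Ix0 u = x u \<and>
        B (A Ix0 u) (A Ix0 u) = 0 \<and> B (A IxN1 u) (A IxN1 u) = 0 \<and>
        (\<forall>i. B (A Ix0 u) (A (Ix i) u) = 0) \<and> B (A Ix0 u) (A IxN u) = 0 \<and>
        (\<forall>i. B (A IxN1 u) (A (Ix i) u) = 0) \<and> B (A IxN1 u) (A IxN u) = 0 \<and>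
        (\<forall>i. B (A (Ix i) u) (A IxN u) = 0) \<and>
        B (A IxN u) (A IxN u) = 1 \<and> B (A Ix0 u) (A IxN1 u) = -1 \<and>
        (\<forall>c. c \<noteq> 0 \<longrightarrow> c \<bullet> (metric B A u *v c) > 0) \<and>
        (\<forall>h. tangent_to_direction B x u h (A IxN u)))"

text \<open>\<open>conn A \<xi> \<eta> u h\<close> is \<open>\<omega>\<^sub>\<xi>\<^sup>\<eta>\<close> at \<open>u\<close>, evaluated on \<open>h\<close>: the coefficient of \<open>A \<eta>\<close> in \<open>dA \<xi>\<close>.\<close>

definition conn ::
  "('i::finite, 'v::real_normed_vector) frame_field \<Rightarrow> 'i frame_index \<Rightarrow> 'i frame_index \<Rightarrow> real^'i \<Rightarrow> real^'i \<Rightarrow> real"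
  where
  "conn A \<xi> \<eta> u h = representation (range (\<lambda>\<zeta>. A \<zeta> u)) (deriv_along (A \<xi>) u h) (A \<eta> u)"

text \<open>The basis forms \<open>\<omega>\<^sup>i = \<omega>\<^sub>0\<^sup>i\<close>.\<close>

definition coframe ::
  "('i::finite, 'v::real_normed_vector) frame_field \<Rightarrow> real^'i \<Rightarrow> real^'i \<Rightarrow> real^'i" where
  "coframe A u h = (\<chi> i. conn A Ix0 (Ix i) u h)"

text \<open>The coefficients \<open>c\<close> in \<open>\<alpha> = c\<^sub>k \<omega>\<^sup>k\<close>, for a 1-form \<open>\<alpha>\<close> at \<open>u\<close>; unique as the \<open>\<omega>\<^sup>k\<close> are a basis.\<close>

definition form_coeffs ::
  "('i::finite, 'v::real_normed_vector) frame_field \<Rightarrow> real^'i \<Rightarrow> (real^'i \<Rightarrow> real) \<Rightarrow> real^'i" where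
  "form_coeffs A u \<alpha> = (THE c. \<forall>h. \<alpha> h = (\<Sum>k\<in>UNIV. c $ k * coframe A u h $ k))"


section \<open>The tensors\<close>

definition lambda2 ::
  "('i::finite, 'v::real_normed_vector) frame_field \<Rightarrow> real^'i \<Rightarrow> real^'i^'i" where
  "lambda2 A u = (\<chi> i j. form_coeffs A u (conn A (Ix i) IxN u) $ j)"

definition lambda3 ::
  "('v::real_normed_vector \<Rightarrow> 'v \<Rightarrow> real) \<Rightarrow> ('i::finite, 'v) frame_field \<Rightarrow> real^'i \<Rightarrow> 'i \<Rightarrow> 'i \<Rightarrow> 'i \<Rightarrow> real"
  where
  "lambda3 B A u i j k =
     form_coeffs A u (\<lambda>h.
         deriv_along (\<lambda>w. lambda2 A w $ i $ j) u h
       - (\<Sum>l\<in>UNIV. lambda2 A u $ l $ j * conn A (Ix i) (Ix l) u h)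
       - (\<Sum>l\<in>UNIV. lambda2 A u $ i $ l * conn A (Ix j) (Ix l) u h)
       + lambda2 A u $ i $ j * conn A Ix0 Ix0 u h
       + metric B A u $ i $ j * conn A IxN Ix0 u h) $ k"

text \<open>Here \<open>CARD('i)\<close> is \<open>n - 1\<close>.\<close>

definition lambda0 ::
  "('v::real_normed_vector \<Rightarrow> 'v \<Rightarrow> real) \<Rightarrow> ('i::finite, 'v) frame_field \<Rightarrow> real^'i \<Rightarrow> real" where
  "lambda0 B A u =
     (\<Sum>i\<in>UNIV. \<Sum>j\<in>UNIV. matrix_inv (metric B A u) $ i $ j * lambda2 A u $ i $ j) / real CARD('i)"

definition a2 ::
  "('v::real_normed_vector \<Rightarrow> 'v \<Rightarrow> real) \<Rightarrow> ('i::finite, 'v) frame_field \<Rightarrow> real^'i \<Rightarrow> real^'i^'i" where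
  "a2 B A u = lambda2 A u - lambda0 B A u *\<^sub>R metric B A u"

text \<open>Row \<open>i\<close>, column \<open>j\<close> of this matrix is \<open>a\<^sup>i\<^sub>j\<close>.\<close>

definition burali_forti ::
  "('v::real_normed_vector \<Rightarrow> 'v \<Rightarrow> real) \<Rightarrow> ('i::finite, 'v) frame_field \<Rightarrow> real^'i \<Rightarrow> real^'i^'i" where
  "burali_forti B A u = matrix_inv (metric B A u) ** a2 B A u"

definition lambda1 ::
  "('v::real_normed_vector \<Rightarrow> 'v \<Rightarrow> real) \<Rightarrow> ('i::finite, 'v) frame_field \<Rightarrow> real^'i \<Rightarrow> real^'i" where
  "lambda1 B A u =
     (\<chi> k. (\<Sum>i\<in>UNIV. \<Sum>j\<in>UNIV. matrix_inv (metric B A u) $ i $ j * lambda3 B A u i j k) / real CARD('i))"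

definition mu ::
  "('v::real_normed_vector \<Rightarrow> 'v \<Rightarrow> real) \<Rightarrow> ('i::finite, 'v) frame_field \<Rightarrow> real^'i \<Rightarrow> real^'i" where
  "mu B A u = matrix_inv (a2 B A u) *v lambda1 B A u"

text \<open>Meaningful where \<open>a2\<close> is invertible.\<close>

definition a3 ::
  "('v::real_normed_vector \<Rightarrow> 'v \<Rightarrow> real) \<Rightarrow> ('i::finite, 'v) frame_field \<Rightarrow> real^'i \<Rightarrow> 'i \<Rightarrow> 'i \<Rightarrow> 'i \<Rightarrow> real"
  where
  "a3 B A u i j k =
     (let a = a2 B A u; g = metric B A u in
      lambda3 B A u i j k +
      (\<Sum>l\<in>UNIV.
         ((a $ i $ j * g $ k $ l + a $ j $ k * g $ i $ l + a $ k $ i * g $ j $ l)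
        - (g $ i $ j * a $ k $ l + g $ j $ k * a $ i $ l + g $ k $ i * a $ j $ l)) * mu B A u $ l))"


section \<open>Principal directions and adapted frames\<close>

definition simple_eigenvalue :: "real^'i^'i::finite \<Rightarrow> real \<Rightarrow> bool" where
  "simple_eigenvalue M s \<longleftrightarrow>
     order s (det (\<chi> i j. [: - (M $ i $ j), if i = j then 1 else 0 :])) = 1"

text \<open>The eigendirection, as a subspace of the tangent space \<open>real^'i\<close> of the parameter domain: the
  vectors whose components \<open>\<omega>\<^sup>i\<close> form an eigenvector of the affinor.\<close>

definition eigendirection ::
  "('v::real_normed_vector \<Rightarrow> 'v \<Rightarrow> real) \<Rightarrow> ('i::finite, 'v) frame_field \<Rightarrow> (real^'i \<Rightarrow> real) \<Rightarrow> real^'i \<Rightarrow> (real^'i) set"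
  where
  "eigendirection B A s u = {h. burali_forti B A u *v coframe A u h = s u *\<^sub>R coframe A u h}"

text \<open>From here on the indices \<open>1, \<dots>, n - 1\<close> are the elements of \<open>'p option\<close>: the index \<open>1\<close> is
  \<open>None\<close>, and the indices \<open>2, \<dots>, n - 1\<close> are the \<open>Some p\<close>; so \<open>CARD('p) = n - 2\<close>.\<close>

definition adapted_frame ::
  "('v::real_normed_vector \<Rightarrow> 'v \<Rightarrow> real) \<Rightarrow> (real^('p::finite option)) set \<Rightarrow> ('p option, 'v) frame_field
     \<Rightarrow> (real^('p option) \<Rightarrow> real) \<Rightarrow> bool" where
  "adapted_frame B U A s \<longleftrightarrow>
     (\<forall>u\<in>U. eigendirection B A s u = {h. \<forall>p. coframe A u h $ Some p = 0} \<and>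
            (\<forall>p. metric B A u $ None $ Some p = 0))"


section \<open>Canal hypersurfaces\<close>

text \<open>The characteristic of a family \<open>Y\<close> of hyperspheres for the parameter value \<open>w\<close> is the
  intersection of the hyperspheres in the span of \<open>Y w\<close> and its partial derivatives.\<close>

definition char_span :: "(real^'k \<Rightarrow> 'v::real_normed_vector) \<Rightarrow> real^'k \<Rightarrow> 'v set" where
  "char_span Y w = span (insert (Y w) (range (deriv_along Y w)))"

definition family_characteristic ::
  "('v::real_normed_vector \<Rightarrow> 'v \<Rightarrow> real) \<Rightarrow> (real^'k \<Rightarrow> 'v) \<Rightarrow> real^'k \<Rightarrow> 'v set" where
  "family_characteristic B Y w = {X. is_point B X \<and> (\<forall>Z\<in>char_span Y w. B X Z = 0)}"

text \<open>An \<open>(n - 2)\<close>-parameter family of hyperspheres whose characteristics are circles: the span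
  has dimension \<open>n - 1\<close> and is positive definite iff its orthogonal complement has signature
  \<open>(2, 1)\<close>, and the points in such a complement form a circle.\<close>

definition sphere_family ::
  "('v::euclidean_space \<Rightarrow> 'v \<Rightarrow> real) \<Rightarrow> (real^'p::finite) set \<Rightarrow> (real^'p \<Rightarrow> 'v) \<Rightarrow> bool" where
  "sphere_family B W Y \<longleftrightarrow> open W \<and> smooth_map_on W Y \<and>
     (\<forall>w\<in>W. is_hypersphere B (Y w) \<and>
            dim (char_span Y w) = CARD('p) + 1 \<and> positive_definite_on B (char_span Y w))"

text \<open>The hypersurface \<open>x\<close> is the envelope of the family: it is tangent at \<open>x u\<close> to the hypersphere
  with parameter \<open>\<phi> u\<close>, along the characteristic of this hypersphere.  The fibres of \<open>\<phi>\<close> are the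
  pieces of the characteristics that lie on the hypersurface.\<close>

definition envelope_of ::
  "('v::euclidean_space \<Rightarrow> 'v \<Rightarrow> real) \<Rightarrow> (real^('p::finite option)) set \<Rightarrow> (real^('p option) \<Rightarrow> 'v)
     \<Rightarrow> (real^'p) set \<Rightarrow> (real^'p \<Rightarrow> 'v) \<Rightarrow> (real^('p option) \<Rightarrow> real^'p) \<Rightarrow> bool" where
  "envelope_of B U x W Y \<phi> \<longleftrightarrow>
     smooth_map_on U \<phi> \<and> \<phi> ` U = W \<and>
     (\<forall>u\<in>U. surj (deriv_along \<phi> u) \<and>
            (\<forall>h. tangent_to_direction B x u h (Y (\<phi> u))) \<and>
            x u \<in> family_characteristic B Y (\<phi> u))"

text \<open>A direction is tangent to a characteristic circle iff it is tangent to all hyperspheres that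
  contain the circle.  The notion is local, as leaves of the directions need not have a global
  parametrization by an open subset of \<open>real^'p\<close>.\<close>

definition one_canal_for ::
  "('v::euclidean_space \<Rightarrow> 'v \<Rightarrow> real) \<Rightarrow> (real^('p::finite option)) set \<Rightarrow> (real^('p option) \<Rightarrow> 'v)
     \<Rightarrow> (real^('p option) \<Rightarrow> (real^('p option)) set) \<Rightarrow> bool" where
  "one_canal_for B U x E \<longleftrightarrow>
     (\<forall>u\<^sub>0\<in>U. \<exists>U' W Y \<phi>. open U' \<and> u\<^sub>0 \<in> U' \<and> U' \<subseteq> U \<and>
        sphere_family B W Y \<and> envelope_of B U' x W Y \<phi> \<and>
        (\<forall>u\<in>U'. \<forall>h\<in>E u. \<forall>Z\<in>char_span Y (\<phi> u). tangent_to_direction B x u h Z))"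

end

theory Submission
  imports Defs
begin

text \<open>
  Let \<open>\<sigma> = \<lambda>\<^sub>1\<^sub>1 / g\<^sub>1\<^sub>1 = \<lambda> + s\<^sub>1\<close> and let \<open>Z = A\<^sub>n + \<sigma> A\<^sub>0\<close> be the tangent hypersphere whose pencil
  \<open>\<sigma> g - \<lambda>\<close> of fundamental forms degenerates exactly along the eigendirection.  As \<open>g\<^sub>1\<^sub>p = a\<^sub>1\<^sub>p = 0\<close>, the
  correction terms of \<open>a\<^sub>1\<^sub>1\<^sub>1\<close> cancel, and the structure equations give \<open>dZ = (a\<^sub>1\<^sub>1\<^sub>1 / g\<^sub>1\<^sub>1) A\<^sub>0\<close> on the vector
  of the eigendirection with \<open>\<omega>\<^sup>1 = 1\<close>.

  If \<open>V\<close> is canal along the eigendirection, the enveloping hyperspheres are multiples of \<open>Z\<close>.  So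
  a nonzero multiple of \<open>a\<^sub>1\<^sub>1\<^sub>1 A\<^sub>0\<close> lies in the span of a hypersphere of the family and its derivatives; this span
  is positive definite and \<open>A\<^sub>0\<close> is isotropic, hence \<open>a\<^sub>1\<^sub>1\<^sub>1 = 0\<close>.  Conversely, if \<open>a\<^sub>1\<^sub>1\<^sub>1 = 0\<close>, the kernel of \<open>dZ\<close>
  is exactly the eigendirection, so by the constant rank theorem \<open>Z\<close> factors locally through a
  submersion onto an open subset of \<open>\<real>\<^sup>n\<^sup>-\<^sup>2\<close>, and \<open>V\<close> is the envelope of this family.
\<close>

section \<open>Calculus of smooth maps\<close>

lemma frechet_derivative_eqI:
  "(f has_derivative f') (at x) \<Longrightarrow> frechet_derivative f (at x) = f'"
  by (metis frechet_derivative_at)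

lemma Ck_on_has_derivative:
  "Ck_on (Suc k) S f \<Longrightarrow> x \<in> S \<Longrightarrow> (f has_derivative frechet_derivative f (at x)) (at x)"
  by (simp add: frechet_derivative_works[symmetric])

lemma Ck_on_deriv: "Ck_on (Suc k) S f \<Longrightarrow> Ck_on k S (\<lambda>x. deriv_along f x v)"
  by simp

text \<open>Openness of \<open>S\<close> makes equality on \<open>S\<close> an equality near each of
  its points, so it passes to all iterated derivatives.\<close>

lemma Ck_on_cong:
  assumes "open S" "\<And>x. x \<in> S \<Longrightarrow> f x = g x" "Ck_on k S f"
  shows "Ck_on k S g"
  using assms(2,3)
proof (induction k arbitrary: f g)
  case 0
  then show ?case by (simp cong: continuous_on_cong)
next
  case (Suc k)
  have D: "(g has_derivative frechet_derivative f (at x)) (at x)" if "x \<in> S" for x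
    using Ck_on_has_derivative[OF Suc.prems(2) that] \<open>open S\<close> that Suc.prems(1)
    by (rule has_derivative_transform_within_open)
  have "Ck_on k S (\<lambda>x. deriv_along g x v)" for v
    by (rule Suc.IH[OF _ Ck_on_deriv[OF Suc.prems(2), of v]])
       (simp add: frechet_derivative_eqI[OF D])
  then show ?case using D by (auto simp: differentiable_def)
qed

text \<open>Allows any explicit formula for the derivative in place of
  \<open>frechet_derivative\<close>. The closure properties below are then inductions on the order
  in which the usual differentiation rules supply the formula.\<close>

lemma Ck_on_SucI:
  assumes "open S" "\<And>x. x \<in> S \<Longrightarrow> (f has_derivative f' x) (at x)"
    "\<And>v. Ck_on k S (\<lambda>x. f' x v)"
  shows "Ck_on (Suc k) S f"
proof -
  have "Ck_on k S (\<lambda>x. deriv_along f x v)" for v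
    by (rule Ck_on_cong[OF assms(1) _ assms(3)[of v]]) (simp add: frechet_derivative_eqI[OF assms(2)])
  then show ?thesis using assms(2) by (auto simp: differentiable_def)
qed

lemma Ck_on_Suc_imp: "Ck_on (Suc k) S f \<Longrightarrow> Ck_on k S f"
proof (induction k arbitrary: f)
  case 0
  then show ?case
    by (auto intro!: continuous_at_imp_continuous_on differentiable_imp_continuous_within)
next
  case (Suc k)
  then show ?case by (metis Ck_on.simps(2))
qed

lemma Ck_on_subset: "Ck_on k S f \<Longrightarrow> T \<subseteq> S \<Longrightarrow> Ck_on k T f"
  by (induction k arbitrary: f) (auto intro: continuous_on_subset)

lemma Ck_on_const: "Ck_on k S (\<lambda>x. c)"
  by (induction k arbitrary: c) auto

lemma Ck_on_bounded_linear:
  assumes "open S" "bounded_linear L" "Ck_on k S f"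
  shows "Ck_on k S (\<lambda>x. L (f x))"
  using assms(3)
proof (induction k arbitrary: f)
  case 0
  then show ?case using assms by (auto intro: bounded_linear.continuous_on)
next
  case (Suc k)
  show ?case
    by (rule Ck_on_SucI[OF assms(1) bounded_linear.has_derivative[OF assms(2)
          Ck_on_has_derivative[OF Suc.prems]] Suc.IH[OF Ck_on_deriv[OF Suc.prems]]])
qed

lemma Ck_on_linear:
  "open S \<Longrightarrow> bounded_linear L \<Longrightarrow> Ck_on k S L"
proof (induction k)
  case 0
  then show ?case by (auto intro: linear_continuous_on)
next
  case (Suc k)
  show ?case
    by (rule Ck_on_SucI[OF Suc.prems(1) bounded_linear_imp_has_derivative[OF Suc.prems(2)] Ck_on_const])
qed

lemma Ck_on_add:
  assumes "open S" "Ck_on k S f" "Ck_on k S g"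
  shows "Ck_on k S (\<lambda>x. f x + g x)"
  using assms(2,3)
proof (induction k arbitrary: f g)
  case 0
  then show ?case by (auto intro: continuous_intros)
next
  case (Suc k)
  show ?case
    by (rule Ck_on_SucI[OF assms(1) has_derivative_add[OF Ck_on_has_derivative[OF Suc.prems(1)]
        Ck_on_has_derivative[OF Suc.prems(2)]]
        Suc.IH[OF Ck_on_deriv[OF Suc.prems(1)] Ck_on_deriv[OF Suc.prems(2)]]])
qed

text \<open>Each summand of the product rule keeps one factor undifferentiated. That factor is
  lowered by \<open>Ck_on_Suc_imp\<close> to the order at which the induction hypothesis
  speaks.\<close>

lemma Ck_on_bilinear:
  assumes "open S" "bounded_bilinear m" "Ck_on k S f" "Ck_on k S g"
  shows "Ck_on k S (\<lambda>x. m (f x) (g x))"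
  using assms(3,4)
proof (induction k arbitrary: f g)
  case 0
  then show ?case using assms(2) by (auto intro: bounded_bilinear.continuous_on)
next
  case (Suc k)
  show ?case
    by (rule Ck_on_SucI[OF assms(1) bounded_bilinear.FDERIV[OF assms(2) Ck_on_has_derivative[OF Suc.prems(1)]
        Ck_on_has_derivative[OF Suc.prems(2)]] Ck_on_add[OF assms(1)
        Suc.IH[OF Ck_on_Suc_imp[OF Suc.prems(1)] Ck_on_deriv[OF Suc.prems(2)]]
        Suc.IH[OF Ck_on_deriv[OF Suc.prems(1)] Ck_on_Suc_imp[OF Suc.prems(2)]]]])
qed

lemma Ck_on_sum:
  assumes "open S" "\<And>i. i \<in> I \<Longrightarrow> Ck_on k S (f i)"
  shows "Ck_on k S (\<lambda>x. \<Sum>i\<in>I. f i x)"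
  using assms(2)
  by (induction I rule: infinite_finite_induct) (auto intro!: Ck_on_const Ck_on_add[OF assms(1)])

lemma Ck_on_prod:
  fixes f :: "'i \<Rightarrow> 'a::real_normed_vector \<Rightarrow> real"
  assumes "open S" "\<And>i. i \<in> I \<Longrightarrow> Ck_on k S (f i)"
  shows "Ck_on k S (\<lambda>x. \<Prod>i\<in>I. f i x)"
  using assms(2)
  by (induction I rule: infinite_finite_induct)
     (auto intro!: Ck_on_const Ck_on_bilinear[OF assms(1) bounded_bilinear_mult])

lemma Ck_on_inverse:
  fixes f :: "'a::real_normed_vector \<Rightarrow> real"
  assumes "open S" "Ck_on k S f" "\<And>x. x \<in> S \<Longrightarrow> f x \<noteq> 0"
  shows "Ck_on k S (\<lambda>x. inverse (f x))"
  using assms(2)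
proof (induction k)
  case 0
  then show ?case using assms(3) by (auto intro: continuous_intros)
next
  case (Suc k)
  have D: "((\<lambda>x. inverse (f x)) has_derivative (\<lambda>v. - (inverse (f x) * deriv_along f x v * inverse (f x)))) (at x)"
    if "x \<in> S" for x
    using Deriv.has_derivative_inverse[OF assms(3)[OF that] Ck_on_has_derivative[OF Suc.prems that]] .
  have I: "Ck_on k S (\<lambda>x. inverse (f x))"
    by (rule Suc.IH[OF Ck_on_Suc_imp[OF Suc.prems]])
  show ?case
    by (rule Ck_on_SucI[OF assms(1) D Ck_on_bounded_linear[OF assms(1) bounded_linear_minus[OF bounded_linear_ident]]])
       (auto intro!: I Ck_on_bilinear[OF assms(1) bounded_bilinear_mult] Ck_on_deriv[OF Suc.prems])
qed

text \<open>In the chain rule the direction \<open>deriv_along f x v\<close> moves with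
  \<open>x\<close>, whereas \<open>Ck_on\<close> controls derivatives in fixed directions only.
  Expanding that direction in \<open>Basis\<close> reduces the derivative to a finite sum of
  products of maps of order \<open>k\<close>.\<close>

lemma Ck_on_compose:
  fixes f :: "'a::real_normed_vector \<Rightarrow> 'b::euclidean_space"
  assumes "open S" "open T" "f ` S \<subseteq> T" "Ck_on k S f" "Ck_on k T g"
  shows "Ck_on k S (\<lambda>x. g (f x))"
  using assms(4,5)
proof (induction k arbitrary: g)
  case 0
  then show ?case using assms(3) by (auto intro: continuous_on_compose2)
next
  case (Suc k)
  have D: "((\<lambda>x. g (f x)) has_derivative
      (\<lambda>v. \<Sum>b\<in>Basis. (deriv_along f x v \<bullet> b) *\<^sub>R deriv_along g (f x) b)) (at x)" if "x \<in> S" for x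
  proof -
    have fx: "f x \<in> T" using that assms(3) by auto
    have G: "(g has_derivative frechet_derivative g (at (f x))) (at (f x))"
      using Ck_on_has_derivative[OF Suc.prems(2) fx] .
    interpret linear "frechet_derivative g (at (f x))"
      using G by (rule has_derivative_linear)
    have "(\<Sum>b\<in>Basis. (w \<bullet> b) *\<^sub>R deriv_along g (f x) b) = deriv_along g (f x) w" for w
      by (subst (2) euclidean_representation[of w, symmetric]) (simp only: sum scale)
    then show ?thesis
      using has_derivative_compose[OF Ck_on_has_derivative[OF Suc.prems(1) that] G] by simp
  qed
  show ?case
    by (rule Ck_on_SucI[OF assms(1) D])
       (auto intro!: Ck_on_sum[OF assms(1)] Ck_on_bilinear[OF assms(1) bounded_bilinear_scaleR]
         Ck_on_bounded_linear[OF assms(1) bounded_linear_inner_left] Ck_on_deriv[OF Suc.prems(1)]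
         Suc.IH[OF Ck_on_Suc_imp[OF Suc.prems(1)] Ck_on_deriv[OF Suc.prems(2)]])
qed

section \<open>Vector-valued maps, determinants, linear systems and local inverses\<close>

lemma Ck_on_vec:
  fixes f :: "'i::finite \<Rightarrow> 'a::real_normed_vector \<Rightarrow> real"
  assumes "open S" "\<And>i. Ck_on k S (f i)"
  shows "Ck_on k S (\<lambda>x. \<chi> i. f i x)"
proof (rule Ck_on_cong[OF assms(1)])
  show "Ck_on k S (\<lambda>x. \<Sum>i\<in>UNIV. f i x *\<^sub>R axis i (1::real))"
    by (intro Ck_on_sum[OF assms(1)] Ck_on_bilinear[OF assms(1) bounded_bilinear_scaleR] assms Ck_on_const)
  show "(\<Sum>i\<in>UNIV. f i x *\<^sub>R axis i (1::real)) = (\<chi> i. f i x)" for x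
    by (simp add: vec_eq_iff axis_def sum_component if_distrib sum.delta cong: if_cong)
qed

lemma Ck_on_det:
  fixes M :: "'i::finite \<Rightarrow> 'i \<Rightarrow> 'a::real_normed_vector \<Rightarrow> real"
  assumes "open S" "\<And>i j. Ck_on k S (M i j)"
  shows "Ck_on k S (\<lambda>x. det (\<chi> i j. M i j x))"
  unfolding det_def
  by (auto intro!: Ck_on_sum[OF assms(1)] Ck_on_bilinear[OF assms(1) bounded_bilinear_mult]
      Ck_on_prod[OF assms(1)] Ck_on_const assms)

text \<open>By Cramer's rule the solution of a linear system is a rational function of its coefficients.\<close>

lemma Ck_on_linear_system:
  fixes M :: "'i::finite \<Rightarrow> 'i \<Rightarrow> 'a::real_normed_vector \<Rightarrow> real" and c :: "'a \<Rightarrow> real^'i"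
  assumes "open S" "\<And>i j. Ck_on k S (M i j)" "\<And>i. Ck_on k S (b i)"
    and "\<And>x. x \<in> S \<Longrightarrow> det (\<chi> i j. M i j x) \<noteq> 0"
    and "\<And>x. x \<in> S \<Longrightarrow> (\<chi> i j. M i j x) *v c x = (\<chi> i. b i x)"
  shows "Ck_on k S c"
proof (rule Ck_on_cong[OF assms(1)])
  let ?N = "\<lambda>l i j. if j = l then b i else M i j"
  have N: "Ck_on k S (?N l i j)" for l i j
    using assms(2,3) by simp
  show "Ck_on k S (\<lambda>x. \<chi> l. det (\<chi> i j. ?N l i j x) * inverse (det (\<chi> i j. M i j x)))"
    by (intro Ck_on_vec Ck_on_bilinear[OF _ bounded_bilinear_mult] Ck_on_inverse Ck_on_det assms N)
  fix x assume x: "x \<in> S"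
  show "(\<chi> l. det (\<chi> i j. ?N l i j x) * inverse (det (\<chi> i j. M i j x))) = c x"
    using assms(5)[OF x] unfolding cramer[OF assms(4)[OF x]]
    by (simp add: divide_inverse if_distrib if_distribR cong: if_cong)
qed

text \<open>Bootstrapping: if \<open>g\<close> has order \<open>k\<close>, so do the partial
  derivatives of \<open>f\<close> at \<open>g y\<close>. The derivative of \<open>g\<close> solves a
  linear system with these coefficients, so it has order \<open>k\<close> as well and
  \<open>g\<close> gains one order. The induction starts from the continuity of \<open>g\<close>,
  which costs one order compared with \<open>f\<close> and is harmless for smooth maps.\<close>

lemma Ck_on_local_inverse:
  fixes f :: "real^'n::finite \<Rightarrow> real^'n"
  assumes "open U" "open V" "Ck_on (Suc k) U f" "g ` V \<subseteq> U"
    and "\<And>y. y \<in> V \<Longrightarrow> (g has_derivative inv (frechet_derivative f (at (g y)))) (at y)"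
    and "\<And>y. y \<in> V \<Longrightarrow> bij (frechet_derivative f (at (g y)))"
  shows "Ck_on k V g"
  using assms(3)
proof (induction k)
  case 0
  then show ?case
    using assms(5) by (auto intro!: continuous_at_imp_continuous_on has_derivative_continuous)
next
  case (Suc k)
  have g: "Ck_on k V g"
    by (rule Suc.IH[OF Ck_on_Suc_imp[OF Suc.prems]])
  have f: "Ck_on k U (\<lambda>x. deriv_along f x v)" for v
    using Suc.prems Ck_on_deriv Ck_on_Suc_imp by blast
  define M where "M i j y = deriv_along f (g y) (axis j 1) $ i" for i j y
  have lin: "linear (frechet_derivative f (at (g y)))" if "y \<in> V" for y
    using Ck_on_has_derivative[OF Suc.prems, of "g y"] assms(4) that
    by (auto intro: has_derivative_linear)
  have Mv: "(\<chi> i j. M i j y) *v w = deriv_along f (g y) w" if "y \<in> V" for y w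
  proof -
    have "(\<chi> i j. M i j y) = matrix (frechet_derivative f (at (g y)))"
      by (simp add: matrix_def M_def)
    then show ?thesis using matrix_works lin[OF that]
      by (metis matrix_vector_mul(2))
  qed
  have "Ck_on k V (\<lambda>y. inv (frechet_derivative f (at (g y))) v)" for v
  proof (rule Ck_on_linear_system[OF assms(2)])
    show "Ck_on k V (M i j)" for i j
      unfolding M_def[abs_def]
      by (rule Ck_on_bounded_linear[OF assms(2) bounded_linear_vec_nth
            Ck_on_compose[OF assms(2,1,4) g f]])
    show "Ck_on k V (\<lambda>y. v $ i)" for i by (rule Ck_on_const)
    fix y assume y: "y \<in> V"
    show "(\<chi> i j. M i j y) *v inv (frechet_derivative f (at (g y))) v = (\<chi> i. v $ i)"
      using assms(6)[OF y] by (simp add: Mv[OF y] bij_is_surj surj_f_inv_f)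
    have "inj ((*v) (\<chi> i j. M i j y))"
      using assms(6)[OF y] by (simp add: Mv[OF y] bij_is_inj cong: inj_on_cong)
    then show "det (\<chi> i j. M i j y) \<noteq> 0"
      by (simp add: invertible_det_nz[symmetric] invertible_left_inverse matrix_left_invertible_injective)
  qed
  then show ?case
    using Ck_on_SucI[OF assms(2,5)] by blast
qed

lemma smooth_map_on_deriv: "smooth_map_on S f \<Longrightarrow> smooth_map_on S (\<lambda>x. deriv_along f x v)"
  unfolding smooth_map_on_def using Ck_on_deriv by blast

lemma smooth_map_on_has_derivative:
  "smooth_map_on S f \<Longrightarrow> x \<in> S \<Longrightarrow> (f has_derivative frechet_derivative f (at x)) (at x)"
  unfolding smooth_map_on_def using Ck_on_has_derivative by blast

lemma smooth_map_on_continuous: "smooth_map_on S f \<Longrightarrow> continuous_on S f"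
  unfolding smooth_map_on_def by (metis Ck_on.simps(1))

lemma smooth_map_on_linear: "smooth_map_on S f \<Longrightarrow> x \<in> S \<Longrightarrow> linear (frechet_derivative f (at x))"
  by (blast intro: has_derivative_linear smooth_map_on_has_derivative)

lemma smooth_map_on_subset: "smooth_map_on S f \<Longrightarrow> T \<subseteq> S \<Longrightarrow> smooth_map_on T f"
  unfolding smooth_map_on_def using Ck_on_subset by blast

section \<open>Symmetry of second derivatives\<close>

lemma mean_value_line:
  fixes f :: "'a::real_normed_vector \<Rightarrow> real"
  assumes "s > 0" "\<And>r. 0 \<le> r \<Longrightarrow> r \<le> s \<Longrightarrow> (f has_derivative f' (p + r *\<^sub>R v)) (at (p + r *\<^sub>R v))"
  obtains r where "0 < r" "r < s" "f (p + s *\<^sub>R v) - f p = s * f' (p + r *\<^sub>R v) v"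
proof -
  have D: "((\<lambda>r. f (p + r *\<^sub>R v)) has_derivative (\<lambda>t. f' (p + r *\<^sub>R v) (t *\<^sub>R v))) (at r)"
    if "0 \<le> r" "r \<le> s" for r
  proof -
    have "((\<lambda>r. p + r *\<^sub>R v) has_derivative (\<lambda>t. t *\<^sub>R v)) (at r)"
      by (auto intro!: derivative_eq_intros)
    from has_derivative_compose[OF this assms(2)[OF that]] show ?thesis .
  qed
  have "((\<lambda>r. f (p + r *\<^sub>R v)) has_real_derivative f' (p + r *\<^sub>R v) v) (at r)"
    if "0 \<le> r" "r \<le> s" for r
  proof -
    have "f' (p + r *\<^sub>R v) (t *\<^sub>R v) = f' (p + r *\<^sub>R v) v * t" for t
      using linear_scale[OF has_derivative_linear[OF assms(2)[OF that]], of t v] by simp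
    then show ?thesis
      using D[OF that] unfolding has_field_derivative_def by simp
  qed
  from MVT2[OF assms(1), of "\<lambda>r. f (p + r *\<^sub>R v)", OF this] that
  show ?thesis by auto
qed

text \<open>Both iterated derivatives are approximated by the same second difference of \<open>f\<close>.\<close>

lemma second_difference:
  fixes f :: "'a::real_normed_vector \<Rightarrow> real"
  assumes "Ck_on 2 S f" "s > 0"
    and "\<And>q r. 0 \<le> q \<Longrightarrow> q \<le> s \<Longrightarrow> 0 \<le> r \<Longrightarrow> r \<le> s \<Longrightarrow> p + q *\<^sub>R v + r *\<^sub>R h \<in> S"
  obtains q r where "0 < q" "q < s" "0 < r" "r < s"
    "f (p + s *\<^sub>R v + s *\<^sub>R h) - f (p + s *\<^sub>R v) - f (p + s *\<^sub>R h) + f p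
      = s * s * deriv_along (\<lambda>w. deriv_along f w v) (p + q *\<^sub>R v + r *\<^sub>R h) h"
proof -
  have f2: "Ck_on (Suc (Suc 0)) S f" using assms(1) by (simp add: numeral_2_eq_2)
  have f1: "Ck_on (Suc 0) S (\<lambda>w. deriv_along f w v)" by (rule Ck_on_deriv[OF f2])
  \<comment> \<open>The second difference is the difference of \<open>F\<close> along
    \<open>v\<close>. The mean value theorem is applied to \<open>F\<close> in direction
    \<open>v\<close> and then, inside the result, in direction \<open>h\<close>.\<close>
  define F where "F y = f (y + s *\<^sub>R h) - f y" for y
  have D: "(F has_derivative (\<lambda>d. deriv_along f (p + q *\<^sub>R v + s *\<^sub>R h) d - deriv_along f (p + q *\<^sub>R v) d))
      (at (p + q *\<^sub>R v))" if "0 \<le> q" "q \<le> s" for q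
  proof -
    have "((\<lambda>y. f (y + s *\<^sub>R h)) has_derivative deriv_along f (p + q *\<^sub>R v + s *\<^sub>R h)) (at (p + q *\<^sub>R v))"
    proof (rule has_derivative_compose[where f = "\<lambda>y. y + s *\<^sub>R h" and g = f])
      show "((\<lambda>y. y + s *\<^sub>R h) has_derivative (\<lambda>d. d)) (at (p + q *\<^sub>R v))"
        by (auto intro!: derivative_eq_intros)
      show "(f has_derivative deriv_along f (p + q *\<^sub>R v + s *\<^sub>R h)) (at (p + q *\<^sub>R v + s *\<^sub>R h))"
        using Ck_on_has_derivative[OF f2 assms(3)[OF that, of s]] assms(2) by simp
    qed
    moreover have "(f has_derivative deriv_along f (p + q *\<^sub>R v)) (at (p + q *\<^sub>R v))"
      using Ck_on_has_derivative[OF f2 assms(3)[OF that, of 0]] assms(2) by simp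
    ultimately show ?thesis unfolding F_def[abs_def] by (rule has_derivative_diff)
  qed
  obtain q where q: "0 < q" "q < s" and eq: "F (p + s *\<^sub>R v) - F p
      = s * (deriv_along f (p + q *\<^sub>R v + s *\<^sub>R h) v - deriv_along f (p + q *\<^sub>R v) v)"
    using mean_value_line[OF assms(2), of F "\<lambda>y d. deriv_along f (y + s *\<^sub>R h) d - deriv_along f y d", OF D]
    by metis
  obtain r where r: "0 < r" "r < s"
    and eq': "deriv_along f (p + q *\<^sub>R v + s *\<^sub>R h) v - deriv_along f (p + q *\<^sub>R v) v
      = s * deriv_along (\<lambda>w. deriv_along f w v) (p + q *\<^sub>R v + r *\<^sub>R h) h"
    using mean_value_line[OF assms(2), of "\<lambda>w. deriv_along f w v"
        "\<lambda>y. frechet_derivative (\<lambda>w. deriv_along f w v) (at y)" "p + q *\<^sub>R v" h]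
      Ck_on_has_derivative[OF f1] assms(3) q by (metis less_imp_le)
  show ?thesis
    using that[OF q r] eq eq' by (simp add: F_def algebra_simps)
qed

lemma second_derivative_symmetric_real:
  fixes f :: "'a::real_normed_vector \<Rightarrow> real"
  assumes "open S" "Ck_on 2 S f" "p \<in> S"
  shows "deriv_along (\<lambda>w. deriv_along f w v) p h = deriv_along (\<lambda>w. deriv_along f w h) p v"
proof (rule ccontr)
  define a b where "a = (\<lambda>y. deriv_along (\<lambda>w. deriv_along f w v) y h)"
    and "b = (\<lambda>y. deriv_along (\<lambda>w. deriv_along f w h) y v)"
  assume "\<not> ?thesis"
  then have ne: "a p \<noteq> b p" by (simp add: a_def b_def)
  \<comment> \<open>Half the gap: values within \<open>e\<close> of \<open>a p\<close> and of
    \<open>b p\<close> respectively cannot coincide.\<close>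
  define e where "e = \<bar>a p - b p\<bar> / 2"
  have e: "e > 0" using ne by (simp add: e_def)
  have cont: "continuous_on S a" "continuous_on S b"
    using assms(2) by (auto simp: a_def b_def numeral_2_eq_2)
  obtain d where d: "d > 0" "\<And>y. dist y p < d \<Longrightarrow> y \<in> S \<and> dist (a y) (a p) < e \<and> dist (b y) (b p) < e"
  proof -
    have "\<forall>\<^sub>F y in nhds p. y \<in> S"
      using assms by (simp add: eventually_nhds_in_open)
    moreover have "\<forall>\<^sub>F y in nhds p. dist (a y) (a p) < e" "\<forall>\<^sub>F y in nhds p. dist (b y) (b p) < e"
      using cont e assms
      by (auto simp: continuous_on_eq_continuous_at isCont_def tendsto_at_iff_tendsto_nhds intro: tendstoD)
    ultimately have "\<forall>\<^sub>F y in nhds p. y \<in> S \<and> dist (a y) (a p) < e \<and> dist (b y) (b p) < e"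
      by eventually_elim auto
    then show ?thesis using that unfolding eventually_nhds_metric by blast
  qed
  \<comment> \<open>The step is small enough for the whole parallelogram at \<open>p\<close> with
    edges \<open>s\<close> times \<open>v\<close> and \<open>h\<close> to lie within distance
    \<open>d\<close>; the summand 1 covers the case that both vectors vanish.\<close>
  define s where "s = d / (2 * (norm v + norm h + 1))"
  have s: "s > 0" using d(1) unfolding s_def by (simp add: add_nonneg_pos)
  have close: "dist (p + q *\<^sub>R v + r *\<^sub>R h) p < d" if "0 \<le> q" "q \<le> s" "0 \<le> r" "r \<le> s" for q r
  proof -
    have "norm (q *\<^sub>R v + r *\<^sub>R h) \<le> q * norm v + r * norm h"
      using norm_triangle_ineq[of "q *\<^sub>R v" "r *\<^sub>R h"] that by simp
    also have "\<dots> \<le> s * norm v + s * norm h"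
      using that by (intro add_mono mult_right_mono) auto
    also have "\<dots> \<le> s * (norm v + norm h + 1)" using s by (simp add: algebra_simps)
    also have "\<dots> = d / 2"
    proof -
      have "norm v + norm h + 1 > 0" by (simp add: add_nonneg_pos)
      then show ?thesis unfolding s_def by (simp add: field_simps del: distrib_left_numeral)
    qed
    also have "\<dots> < d" using d(1) by simp
    finally show ?thesis by (simp add: dist_norm add.assoc)
  qed
  obtain q r where qr: "0 < q" "q < s" "0 < r" "r < s" "f (p + s *\<^sub>R v + s *\<^sub>R h) - f (p + s *\<^sub>R v) - f (p + s *\<^sub>R h) + f p
      = s * s * a (p + q *\<^sub>R v + r *\<^sub>R h)"
    using second_difference[OF assms(2) s, of p v h] d(2)[OF close] unfolding a_def by metis
  have close': "dist (p + q *\<^sub>R h + r *\<^sub>R v) p < d" if "0 \<le> q" "q \<le> s" "0 \<le> r" "r \<le> s" for q r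
    using close[of r q] that by (simp add: ac_simps)
  obtain q' r' where qr': "0 < q'" "q' < s" "0 < r'" "r' < s" "f (p + s *\<^sub>R h + s *\<^sub>R v) - f (p + s *\<^sub>R h) - f (p + s *\<^sub>R v) + f p
      = s * s * b (p + q' *\<^sub>R h + r' *\<^sub>R v)"
    using second_difference[OF assms(2) s, of p h v] d(2)[OF close'] unfolding b_def by metis
  have "s * s * a (p + q *\<^sub>R v + r *\<^sub>R h) = s * s * b (p + q' *\<^sub>R h + r' *\<^sub>R v)"
    using qr(5) qr'(5) by (simp add: algebra_simps)
  then have "a (p + q *\<^sub>R v + r *\<^sub>R h) = b (p + q' *\<^sub>R h + r' *\<^sub>R v)"
    using s by simp
  moreover have "dist (a (p + q *\<^sub>R v + r *\<^sub>R h)) (a p) < e"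
    using d(2)[OF close] qr by auto
  moreover have "dist (b (p + q' *\<^sub>R h + r' *\<^sub>R v)) (b p) < e"
    using d(2)[OF close'] qr' by auto
  ultimately show False unfolding e_def dist_real_def by argo
qed

section \<open>Maps factoring through a submersion\<close>

lemma has_derivative_vec:
  fixes f :: "'a::real_normed_vector \<Rightarrow> 'i::finite \<Rightarrow> real"
  assumes "\<And>i. ((\<lambda>x. f x i) has_derivative (\<lambda>h. f' h i)) F"
  shows "((\<lambda>x. \<chi> i. f x i) has_derivative (\<lambda>h. \<chi> i. f' h i)) F"
proof -
  have "((\<lambda>x. \<Sum>i\<in>UNIV. f x i *\<^sub>R axis i (1::real)) has_derivative (\<lambda>h. \<Sum>i\<in>UNIV. f' h i *\<^sub>R axis i 1)) F"
    by (intro has_derivative_sum has_derivative_scaleR_left assms)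
  moreover have "(\<Sum>i\<in>UNIV. c i *\<^sub>R axis i (1::real)) = (\<chi> i. c i)" for c :: "'i \<Rightarrow> real"
    by (simp add: vec_eq_iff axis_def sum_component if_distrib sum.delta cong: if_cong)
  ultimately show ?thesis by simp
qed

text \<open>Splits off the coordinate with index \<open>None\<close>. It serves as the coordinate
  along the fibres when a submersion onto \<open>real^'p\<close> is completed to a local
  diffeomorphism.\<close>

definition vec_option :: "real \<Rightarrow> real^'p \<Rightarrow> real^('p option)" where
  "vec_option t w = (\<chi> i. case i of None \<Rightarrow> t | Some p \<Rightarrow> w $ p)"

lemma vec_option_nth [simp]: "vec_option t w $ None = t" "vec_option t w $ Some p = w $ p"
  by (simp_all add: vec_option_def)

lemma vec_option_eq_iff: "v = vec_option t w \<longleftrightarrow> v $ None = t \<and> (\<forall>p. v $ Some p = w $ p)"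
  by (simp add: vec_eq_iff split_option_all)

lemma vec_option_eq_0_iff: "vec_option t w = 0 \<longleftrightarrow> t = 0 \<and> w = 0"
  by (simp add: vec_eq_iff split_option_all)

lemma Ck_on_vec_option:
  fixes f :: "'a::real_normed_vector \<Rightarrow> real^'p::finite"
  assumes "open S" "Ck_on k S l" "Ck_on k S f"
  shows "Ck_on k S (\<lambda>x. vec_option (l x) (f x))"
  unfolding vec_option_def
proof (rule Ck_on_vec[OF assms(1)])
  show "Ck_on k S (\<lambda>x. case i of None \<Rightarrow> l x | Some p \<Rightarrow> f x $ p)" for i
    using assms Ck_on_bounded_linear[OF assms(1) bounded_linear_vec_nth assms(3)] by (cases i) auto
qed

lemma has_derivative_vec_option:
  fixes f :: "'a::real_normed_vector \<Rightarrow> real^'p::finite"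
  assumes "(l has_derivative l') F" "(f has_derivative f') F"
  shows "((\<lambda>x. vec_option (l x) (f x)) has_derivative (\<lambda>h. vec_option (l' h) (f' h))) F"
  unfolding vec_option_def
proof (rule has_derivative_vec)
  show "((\<lambda>x. case i of None \<Rightarrow> l x | Some p \<Rightarrow> f x $ p) has_derivative
      (\<lambda>h. case i of None \<Rightarrow> l' h | Some p \<Rightarrow> f' h $ p)) F" for i
    using assms bounded_linear.has_derivative[OF bounded_linear_vec_nth assms(2)] by (cases i) auto
qed

text \<open>The inverse function theorem gives a differentiable inverse \<open>g\<close> with a
  known derivative; \<open>Ck_on_local_inverse\<close>, used at every order, makes it
  smooth.\<close>

lemma inverse_function_smooth:
  fixes f :: "real^'n::finite \<Rightarrow> real^'n"
  assumes "open U" "u\<^sub>0 \<in> U" "smooth_map_on U f" "inj (frechet_derivative f (at u\<^sub>0))"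
  obtains U' V g where "open U'" "U' \<subseteq> U" "u\<^sub>0 \<in> U'" "open V" "f u\<^sub>0 \<in> V" "homeomorphism U' V f g"
    "smooth_map_on V g" "\<And>y. y \<in> V \<Longrightarrow> (g has_derivative inv (frechet_derivative f (at (g y)))) (at y)"
    "\<And>y. y \<in> V \<Longrightarrow> bij (frechet_derivative f (at (g y)))"
proof -
  have bl: "bounded_linear (frechet_derivative f (at u))" if "u \<in> U" for u
    using smooth_map_on_has_derivative[OF assms(3) that] by (rule has_derivative_bounded_linear)
  define f' where "f' u = Blinfun (frechet_derivative f (at u))" for u
  have f': "blinfun_apply (f' u) = frechet_derivative f (at u)" if "u \<in> U" for u
    unfolding f'_def by (rule bounded_linear_Blinfun_apply[OF bl[OF that]])
  have D: "(f has_derivative blinfun_apply (f' u)) (at u)" if "u \<in> U" for u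
    using smooth_map_on_has_derivative[OF assms(3) that] by (simp add: f'[OF that])
  \<comment> \<open>In finite dimension, continuity in the operator norm reduces to continuity of
    the values on basis vectors, that is, of the directional derivatives.\<close>
  have C: "continuous_on U f'"
  proof (rule continuous_on_blinfun_componentwise)
    fix b :: "real^'n"
    have "continuous_on U (\<lambda>u. deriv_along f u b)"
      by (intro smooth_map_on_continuous smooth_map_on_deriv assms)
    then show "continuous_on U (\<lambda>u. blinfun_apply (f' u) b)"
      by (simp add: f' cong: continuous_on_cong)
  qed
  have lin0: "linear (frechet_derivative f (at u\<^sub>0))"
    using bl[OF assms(2)] by (rule bounded_linear.linear)
  have "bij (frechet_derivative f (at u\<^sub>0))"
    using linear_injective_imp_surjective[OF lin0 assms(4)] assms(4) by (simp add: bij_def)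
  moreover have "bounded_linear (inv (frechet_derivative f (at u\<^sub>0)))"
    using inj_linear_imp_inv_bounded_linear[OF bl[OF assms(2)] assms(4)] .
  ultimately have "Blinfun (inv (frechet_derivative f (at u\<^sub>0))) o\<^sub>L f' u\<^sub>0 = id_blinfun"
    by (intro blinfun_eqI) (simp add: f'[OF assms(2)] bounded_linear_Blinfun_apply bij_is_inj)
  from inverse_function_theorem[OF assms(1) D C assms(2) this]
  obtain U' V g g' where *: "open U'" "U' \<subseteq> U" "u\<^sub>0 \<in> U'" "open V" "f u\<^sub>0 \<in> V" "homeomorphism U' V f g"
    and g: "\<And>y. y \<in> V \<Longrightarrow> (g has_derivative g' y) (at y)" "\<And>y. y \<in> V \<Longrightarrow> g' y = inv (blinfun_apply (f' (g y)))"
      "\<And>y. y \<in> V \<Longrightarrow> bij (blinfun_apply (f' (g y)))"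
    by metis
  have gU: "g ` V \<subseteq> U" using *(2,6) by (auto simp: homeomorphism_def)
  have g'': "(g has_derivative inv (frechet_derivative f (at (g y)))) (at y)"
    "bij (frechet_derivative f (at (g y)))" if "y \<in> V" for y
    using g[OF that] f'[of "g y"] gU that by auto
  have "smooth_map_on V g"
    unfolding smooth_map_on_def
    using Ck_on_local_inverse[OF assms(1) *(4) _ gU g''] assms(3) unfolding smooth_map_on_def by blast
  then show ?thesis using that * g'' by blast
qed

text \<open>The pair of \<open>l\<close> and \<open>\<phi>\<close> is a local diffeomorphism near
  \<open>u\<^sub>0\<close>. In these coordinates the fibres of \<open>\<phi>\<close> are segments in
  the direction of the \<open>None\<close> coordinate. The common kernel vector given by
  \<open>ker\<close> spans that direction, so \<open>Z\<close> is constant on the segments and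
  depends on \<open>\<phi>\<close> alone.\<close>

lemma factor_through_submersion:
  fixes Z :: "real^('p::finite option) \<Rightarrow> 'v::euclidean_space" and \<phi> :: "real^('p option) \<Rightarrow> real^'p"
  assumes "open U" "u\<^sub>0 \<in> U" "smooth_map_on U Z" "smooth_map_on U \<phi>" "linear l"
    and inj0: "\<And>h. deriv_along \<phi> u\<^sub>0 h = 0 \<Longrightarrow> l h = (0::real) \<Longrightarrow> h = 0"
    and ker: "\<And>u. u \<in> U \<Longrightarrow> \<exists>k. k \<noteq> 0 \<and> deriv_along \<phi> u k = 0 \<and> deriv_along Z u k = 0"
  obtains U' W Y where "open U'" "u\<^sub>0 \<in> U'" "U' \<subseteq> U" "open W" "smooth_map_on W Y" "\<phi> ` U' = W"
    "\<And>u. u \<in> U' \<Longrightarrow> surj (deriv_along \<phi> u)" "\<And>u. u \<in> U' \<Longrightarrow> Z u = Y (\<phi> u)"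
proof -
  define \<Phi> where "\<Phi> u = vec_option (l u) (\<phi> u)" for u
  have bl: "bounded_linear l" using assms(5) by (rule linear_conv_bounded_linear[THEN iffD1])
  have smooth_\<Phi>: "smooth_map_on U \<Phi>"
    using assms(4) Ck_on_linear[OF assms(1) bl]
    unfolding smooth_map_on_def \<Phi>_def[abs_def] by (blast intro: Ck_on_vec_option[OF assms(1)])
  have d\<Phi>: "deriv_along \<Phi> u = (\<lambda>h. vec_option (l h) (deriv_along \<phi> u h))" if "u \<in> U" for u
    unfolding \<Phi>_def[abs_def]
    by (intro frechet_derivative_eqI has_derivative_vec_option bounded_linear_imp_has_derivative bl
        smooth_map_on_has_derivative[OF assms(4) that])
  have "inj (deriv_along \<Phi> u\<^sub>0)"
    unfolding linear_injective_0[OF smooth_map_on_linear[OF smooth_\<Phi> assms(2)]]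
    using inj0 by (simp add: d\<Phi>[OF assms(2)] vec_option_eq_0_iff)
  from inverse_function_smooth[OF assms(1,2) smooth_\<Phi> this]
  obtain U1 V g where U1: "open U1" "U1 \<subseteq> U" "u\<^sub>0 \<in> U1" "open V" "\<Phi> u\<^sub>0 \<in> V"
    and hom: "homeomorphism U1 V \<Phi> g" and smooth_g: "smooth_map_on V g"
    and dg: "\<And>y. y \<in> V \<Longrightarrow> (g has_derivative inv (frechet_derivative \<Phi> (at (g y)))) (at y)"
    and bij: "\<And>y. y \<in> V \<Longrightarrow> bij (frechet_derivative \<Phi> (at (g y)))"
    by metis
  have gU1: "g y \<in> U1" "\<Phi> (g y) = y" if "y \<in> V" for y
    using hom that by (auto simp: homeomorphism_def)
  \<comment> \<open>A box around the image of \<open>u\<^sub>0\<close> inside \<open>V\<close>: its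
    product form makes every fibre over \<open>W\<close> a full segment.\<close>
  obtain N where N: "\<And>i. open (N i)" "\<And>i. \<Phi> u\<^sub>0 $ i \<in> N i" "\<And>y. (\<And>i. y $ i \<in> N i) \<Longrightarrow> y \<in> V"
    using U1(4,5) unfolding open_vec_def by metis
  define t\<^sub>0 where "t\<^sub>0 = l u\<^sub>0"
  obtain e where e: "e > 0" "ball t\<^sub>0 e \<subseteq> N None"
    using N(1,2)[of None] by (auto simp: open_contains_ball \<Phi>_def t\<^sub>0_def)
  define W where "W = {w. \<forall>p. w $ p \<in> N (Some p)}"
  have inV: "vec_option t w \<in> V" if "t \<in> ball t\<^sub>0 e" "w \<in> W" for t w
  proof (rule N(3))
    show "vec_option t w $ i \<in> N i" for i
      using that e(2) by (cases i) (auto simp: W_def)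
  qed
  have openW: "open W"
    unfolding open_vec_def using N(1) by (auto simp: W_def intro!: exI[of _ "\<lambda>p. N (Some p)"])
  define U' where "U' = U1 \<inter> (l -` ball t\<^sub>0 e \<inter> (U1 \<inter> \<phi> -` W))"
  \<comment> \<open>The value of \<open>Z\<close> on the slice \<open>l = t\<^sub>0\<close>, which
    meets each fibre over \<open>W\<close> exactly once.\<close>
  define Y where "Y w = Z (g (vec_option t\<^sub>0 w))" for w
  have t\<^sub>0: "t\<^sub>0 \<in> ball t\<^sub>0 e" using e(1) by simp
  show ?thesis
  proof
    have "continuous_on U1 \<phi>"
      using smooth_map_on_continuous[OF assms(4)] U1(2) continuous_on_subset by blast
    then have "open (U1 \<inter> \<phi> -` W)"
      using continuous_open_preimage U1(1) openW by blast
    moreover have "open (l -` ball t\<^sub>0 e)"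
      using linear_continuous_on[OF bl] by (intro open_vimage) auto
    ultimately show "open U'" unfolding U'_def using U1(1) by blast
    show "u\<^sub>0 \<in> U'"
      using U1(3) t\<^sub>0 N(2)[of "Some _"] by (auto simp: U'_def W_def t\<^sub>0_def \<Phi>_def)
    show "U' \<subseteq> U" using U1(2) by (auto simp: U'_def)
    show "open W" by (rule openW)
    have g0: "Ck_on k W (\<lambda>w. g (vec_option t\<^sub>0 w))" for k
    proof (rule Ck_on_compose[where f = "vec_option t\<^sub>0" and g = g, OF openW U1(4)])
      show "vec_option t\<^sub>0 ` W \<subseteq> V" using inV[OF t\<^sub>0] by auto
      show "Ck_on k W (vec_option t\<^sub>0)"
        using Ck_on_vec_option[OF openW Ck_on_const Ck_on_linear[OF openW bounded_linear_ident]] .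
      show "Ck_on k V g" using smooth_g unfolding smooth_map_on_def by blast
    qed
    have "Ck_on k W Y" for k
      unfolding Y_def[abs_def]
    proof (rule Ck_on_compose[OF openW assms(1) _ g0])
      show "(\<lambda>w. g (vec_option t\<^sub>0 w)) ` W \<subseteq> U" using inV[OF t\<^sub>0] gU1 U1(2) by auto
      show "Ck_on k U Z" using assms(3) unfolding smooth_map_on_def by blast
    qed
    then show "smooth_map_on W Y" unfolding smooth_map_on_def by blast
    show "\<phi> ` U' = W"
    proof
      show "W \<subseteq> \<phi> ` U'"
      proof
        fix w assume w: "w \<in> W"
        define u where "u = g (vec_option t\<^sub>0 w)"
        have "u \<in> U1" "\<Phi> u = vec_option t\<^sub>0 w" using gU1 inV[OF t\<^sub>0 w] by (auto simp: u_def)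
        then have "\<phi> u = w" "l u = t\<^sub>0"
          by (simp_all add: \<Phi>_def vec_option_eq_iff) (simp add: vec_eq_iff)
        then show "w \<in> \<phi> ` U'" using \<open>u \<in> U1\<close> w t\<^sub>0 by (auto simp: U'_def)
      qed
    qed (auto simp: U'_def)
    fix u assume u: "u \<in> U'"
    have uU: "u \<in> U" and lu: "l u \<in> ball t\<^sub>0 e" and fu: "\<phi> u \<in> W" and u1: "u \<in> U1"
      using u U1(2) by (auto simp: U'_def)
    have gu: "g (\<Phi> u) = u" and \<Phi>uV: "\<Phi> u \<in> V" using hom u1 by (auto simp: homeomorphism_def)
    show "surj (deriv_along \<phi> u)"
    proof (rule surjI)
      fix w
      have "surj (deriv_along \<Phi> u)" using bij[OF \<Phi>uV] by (simp add: gu bij_is_surj)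
      then have "deriv_along \<Phi> u (inv (deriv_along \<Phi> u) (vec_option 0 w)) = vec_option 0 w"
        by (rule surj_f_inv_f)
      then show "deriv_along \<phi> u (inv (deriv_along \<Phi> u) (vec_option 0 w)) = w"
        by (simp add: d\<Phi>[OF uU] vec_option_eq_iff) (simp add: vec_eq_iff)
    qed
    \<comment> \<open>Along a fibre the derivative of \<open>Z\<close> vanishes: the inverse of the
      coordinate map sends the \<open>None\<close> direction to a multiple of the kernel vector
      \<open>k\<close>.\<close>
    have D: "((\<lambda>t. Z (g (vec_option t (\<phi> u)))) has_derivative (\<lambda>d. 0)) (at t)" if t: "t \<in> ball t\<^sub>0 e" for t
    proof -
      define y where "y = vec_option t (\<phi> u)"
      have y: "y \<in> V" unfolding y_def by (rule inV[OF t fu])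
      then have gy: "g y \<in> U" using gU1 U1(2) by auto
      have d1: "((\<lambda>t. vec_option t (\<phi> u)) has_derivative (\<lambda>d. vec_option d 0)) (at t)"
        by (intro has_derivative_vec_option has_derivative_ident has_derivative_const)
      have d2: "((\<lambda>t. Z (g (vec_option t (\<phi> u)))) has_derivative
          (\<lambda>d. deriv_along Z (g y) (inv (deriv_along \<Phi> (g y)) (vec_option d 0)))) (at t)"
        unfolding y_def
        by (intro has_derivative_compose[OF has_derivative_compose[OF d1], of g _ Z]
            smooth_map_on_has_derivative[OF assms(3)] dg gy[unfolded y_def] y[unfolded y_def])
      obtain k where k: "k \<noteq> 0" "deriv_along \<phi> (g y) k = 0" "deriv_along Z (g y) k = 0"
        using ker[OF gy] by blast
      interpret L: linear "deriv_along \<Phi> (g y)" by (rule smooth_map_on_linear[OF smooth_\<Phi> gy])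
      have dk: "deriv_along \<Phi> (g y) k = vec_option (l k) 0" using k(2) by (simp add: d\<Phi>[OF gy])
      \<comment> \<open>Both components of the derivative of \<open>\<Phi>\<close> would otherwise
        vanish on the nonzero vector \<open>k\<close>, against injectivity.\<close>
      have lk: "l k \<noteq> 0"
      proof
        assume "l k = 0"
        then have "deriv_along \<Phi> (g y) k = deriv_along \<Phi> (g y) 0"
          using dk by (simp add: vec_eq_iff vec_option_def split: option.split)
        then show False using bij[OF y] k(1) by (metis bij_is_inj injD)
      qed
      have "inv (deriv_along \<Phi> (g y)) (vec_option d 0) = (d / l k) *\<^sub>R k" for d
      proof (rule inv_f_eq[OF bij_is_inj[OF bij[OF y]]])
        show "deriv_along \<Phi> (g y) ((d / l k) *\<^sub>R k) = vec_option d 0"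
          using lk by (simp add: L.scale dk vec_option_eq_iff)
      qed
      then have "deriv_along Z (g y) (inv (deriv_along \<Phi> (g y)) (vec_option d 0)) = 0" for d
        using linear_scale[OF smooth_map_on_linear[OF assms(3) gy]] k(3) by simp
      then show ?thesis using d2 by simp
    qed
    \<comment> \<open>The interval around \<open>t\<^sub>0\<close> is convex, so the zero derivative
      allows moving from \<open>u\<close> to the slice within its fibre.\<close>
    have "Z (g (vec_option (l u) (\<phi> u))) = Z (g (vec_option t\<^sub>0 (\<phi> u)))"
      by (rule has_derivative_zero_unique[where s = "ball t\<^sub>0 e", OF convex_ball
            has_derivative_at_withinI[OF D] lu t\<^sub>0])
    then show "Z u = Y (\<phi> u)" using gu by (simp add: Y_def \<Phi>_def)
  qed
qed

section \<open>Conformal frames\<close>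

lemma UNIV_frame_index:
  "(UNIV :: 'i frame_index set) = insert Ix0 (insert IxN (insert IxN1 (range Ix)))"
proof -
  have "\<xi> \<in> insert Ix0 (insert IxN (insert IxN1 (range Ix)))" for \<xi> :: "'i frame_index"
    by (cases \<xi>) auto
  then show ?thesis by blast
qed

lemma finite_frame_index: "finite (UNIV :: 'i::finite frame_index set)"
  by (simp add: UNIV_frame_index)

lemma sum_frame_index:
  fixes f :: "'i::finite frame_index \<Rightarrow> 'a::comm_monoid_add"
  shows "sum f UNIV = f Ix0 + (f IxN + (f IxN1 + (\<Sum>i\<in>UNIV. f (Ix i))))"
proof -
  have "inj (Ix :: 'i \<Rightarrow> _)" by (rule injI) simp
  then show ?thesis
    by (simp add: UNIV_frame_index sum.reindex image_iff)
qed

lemma card_frame_index: "card (UNIV :: 'i::finite frame_index set) = CARD('i) + 3"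
proof -
  have "card (UNIV :: 'i frame_index set) = (\<Sum>_\<in>(UNIV :: 'i frame_index set). 1)" by simp
  then show ?thesis unfolding sum_frame_index by simp
qed

lemma det_nonzeroI:
  fixes M :: "real^'n^'n"
  assumes "\<And>c. M *v c = 0 \<Longrightarrow> c = 0"
  shows "det M \<noteq> 0"
  using assms by (metis invertible_det_nz invertible_left_inverse matrix_left_invertible_ker)

section \<open>Symmetric bilinear forms and the product rule\<close>

locale bilinear_space =
  fixes B :: "'v::euclidean_space \<Rightarrow> 'v \<Rightarrow> real"
  assumes bilinear_B: "bilinear B" and sym: "\<And>X Y. B X Y = B Y X"
begin

lemma bounded_bilinear_B: "bounded_bilinear B"
  using bilinear_B by (simp add: bilinear_conv_bounded_bilinear)

lemmas B_simps = bilinear_ladd[OF bilinear_B] bilinear_radd[OF bilinear_B]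
  bilinear_lmul[OF bilinear_B] bilinear_rmul[OF bilinear_B]
  bilinear_lzero[OF bilinear_B] bilinear_rzero[OF bilinear_B]
  bilinear_lneg[OF bilinear_B] bilinear_rneg[OF bilinear_B]
  bilinear_lsub[OF bilinear_B] bilinear_rsub[OF bilinear_B]

lemma B_sum_left: "B (\<Sum>i\<in>I. f i) Y = (\<Sum>i\<in>I. B (f i) Y)"
  by (induction I rule: infinite_finite_induct) (auto simp: B_simps)

lemma B_sum_right: "B Y (\<Sum>i\<in>I. f i) = (\<Sum>i\<in>I. B Y (f i))"
  using B_sum_left sym by simp

lemma smooth_B:
  "open S \<Longrightarrow> smooth_map_on S X \<Longrightarrow> smooth_map_on S Y \<Longrightarrow> smooth_map_on S (\<lambda>w. B (X w) (Y w))"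
  unfolding smooth_map_on_def by (blast intro: Ck_on_bilinear[OF _ bounded_bilinear_B])

lemma deriv_B:
  assumes "X differentiable at u" "Y differentiable at u"
  shows "deriv_along (\<lambda>w. B (X w) (Y w)) u h = B (X u) (deriv_along Y u h) + B (deriv_along X u h) (Y u)"
  by (simp add: frechet_derivative_eqI[OF bounded_bilinear.FDERIV[OF bounded_bilinear_B
      assms[unfolded frechet_derivative_works]]])

text \<open>Source of the relations between connection forms: each constant product of frame vectors
  is differentiated by this rule.\<close>

lemma deriv_B_const:
  assumes "open S" "u \<in> S" "X differentiable at u" "Y differentiable at u" "\<And>w. w \<in> S \<Longrightarrow> B (X w) (Y w) = c"
  shows "B (X u) (deriv_along Y u h) + B (deriv_along X u h) (Y u) = 0"
proof -
  have "deriv_along (\<lambda>w. c) u h = deriv_along (\<lambda>w. B (X w) (Y w)) u h"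
    by (rule fun_cong[OF frechet_derivative_transform_within_open[OF _ assms(1,2)]])
       (simp_all add: assms(5))
  then show ?thesis by (simp add: deriv_B[OF assms(3,4)])
qed

end

section \<open>Linear algebra of a conformal frame at one point\<close>

locale frame_at = bilinear_space B for B :: "'v::euclidean_space \<Rightarrow> 'v \<Rightarrow> real" +
  fixes F :: "'i::finite frame_index \<Rightarrow> 'v"
  assumes dim: "DIM('v) = CARD('i) + 3"
    and gram: "B (F Ix0) (F Ix0) = 0" "B (F IxN1) (F IxN1) = 0" "B (F Ix0) (F (Ix i)) = 0"
      "B (F Ix0) (F IxN) = 0" "B (F IxN1) (F (Ix i)) = 0" "B (F IxN1) (F IxN) = 0"
      "B (F (Ix i)) (F IxN) = 0" "B (F IxN) (F IxN) = 1" "B (F Ix0) (F IxN1) = -1"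
    and posdef: "c \<noteq> 0 \<Longrightarrow> c \<bullet> ((\<chi> i j. B (F (Ix i)) (F (Ix j))) *v c) > 0"
begin

lemma gram_sym: "B (F (Ix i)) (F Ix0) = 0" "B (F IxN) (F Ix0) = 0" "B (F (Ix i)) (F IxN1) = 0"
  "B (F IxN) (F IxN1) = 0" "B (F IxN) (F (Ix i)) = 0" "B (F IxN1) (F Ix0) = -1"
  using gram sym by metis+

text \<open>The isotropic vectors \<open>F Ix0\<close> and \<open>F IxN1\<close> are dual to each
  other up to sign, so each one reads off the coefficient of the other. The tangential coefficients
  appear with their index lowered by the metric.\<close>

lemma B_comb:
  assumes "X = (\<Sum>\<xi>\<in>UNIV. r \<xi> *\<^sub>R F \<xi>)"
  shows "B X (F Ix0) = - r IxN1" "B X (F IxN1) = - r Ix0" "B X (F IxN) = r IxN"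
    "B X (F (Ix i)) = (\<Sum>j\<in>UNIV. B (F (Ix i)) (F (Ix j)) * r (Ix j))"
  unfolding assms sum_frame_index
  by (simp_all add: B_simps B_sum_left gram gram_sym mult.commute sym[of "F (Ix i)"])

lemma comb_zero:
  assumes "(\<Sum>\<xi>\<in>UNIV. r \<xi> *\<^sub>R F \<xi>) = 0"
  shows "r \<xi> = 0"
proof -
  note * = B_comb[OF assms[symmetric], unfolded bilinear_lzero[OF bilinear_B]]
  define c where "c = (\<chi> j. r (Ix j))"
  have "(\<chi> i j. B (F (Ix i)) (F (Ix j))) *v c = 0"
    using *(4) by (simp add: vec_eq_iff matrix_vector_mult_def c_def)
  then have "c = 0" using posdef[of c] by auto
  then have "r (Ix j) = 0" for j by (simp add: c_def vec_eq_iff)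
  then show ?thesis using * by (cases \<xi>) auto
qed

text \<open>\<open>representation\<close> refers to the frame as a set of vectors; injectivity
  allows passing between vectors and frame indices in sums.\<close>

lemma inj_F: "inj F"
proof (rule injI)
  fix \<xi> \<eta> assume eq: "F \<xi> = F \<eta>"
  \<comment> \<open>The difference of the indicator functions of the two indices: a linear relation
    if their vectors coincide, and nontrivial unless the indices do.\<close>
  define r where "r \<zeta> = (if \<zeta> = \<xi> then 1 else 0) - (if \<zeta> = \<eta> then 1 else 0 :: real)" for \<zeta>
  have "(\<Sum>\<zeta>\<in>UNIV. r \<zeta> *\<^sub>R F \<zeta>) = (\<Sum>\<zeta>\<in>UNIV. if \<zeta> = \<xi> then F \<zeta> else 0) - (\<Sum>\<zeta>\<in>UNIV. if \<zeta> = \<eta> then F \<zeta> else 0)"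
    unfolding sum_subtractf[symmetric] by (intro sum.cong) (auto simp: r_def)
  also have "\<dots> = 0" using eq by (simp add: finite_frame_index)
  finally show "\<xi> = \<eta>" using comb_zero[of r \<xi>] by (simp add: r_def split: if_splits)
qed

lemma independent_F: "independent (range F)"
proof (rule independent_if_scalars_zero)
  show "finite (range F)" by (rule finite_imageI[OF finite_frame_index])
  fix f X assume "(\<Sum>X\<in>range F. f X *\<^sub>R X) = 0" "X \<in> range F"
  then show "f X = 0" using comb_zero[of "\<lambda>\<xi>. f (F \<xi>)"] inj_F by (auto simp: sum.reindex)
qed

text \<open>An independent set with as many elements as the dimension
  \<open>CARD('i) + 3\<close>.\<close>

lemma span_F: "span (range F) = UNIV"
proof -
  have "card (range F) = DIM('v)"
    using card_image[OF inj_F] by (simp add: card_frame_index dim)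
  then have "UNIV \<subseteq> span (range F)"
    using card_ge_dim_independent[OF _ independent_F, of UNIV] by (simp add: dim_UNIV)
  then show ?thesis by blast
qed

abbreviation coord :: "'i frame_index \<Rightarrow> 'v \<Rightarrow> real" where
  "coord \<xi> X \<equiv> representation (range F) X (F \<xi>)"

lemma coord_expand: "X = (\<Sum>\<xi>\<in>UNIV. coord \<xi> X *\<^sub>R F \<xi>)"
proof -
  have "finite (range F)" by (rule finite_imageI[OF finite_frame_index])
  then show ?thesis
    using sum_representation_eq[OF independent_F, of X "range F"] inj_F by (simp add: span_F sum.reindex)
qed

lemmas B_coord = B_comb[OF coord_expand]

lemma linear_coord: "linear (coord \<xi>)"
  by (simp add: representation_add[OF independent_F] representation_scale[OF independent_F] span_F linear_iff)

text \<open>The first two conditions remove the components along \<open>F IxN1\<close> and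
  \<open>F IxN\<close>. The component along \<open>F Ix0\<close> is isotropic and orthogonal to the
  rest, so \<open>B X X\<close> is the metric applied to the tangential components.\<close>

lemma tangential_B_pos:
  assumes "B X (F Ix0) = 0" "B X (F IxN) = 0" "B X (F (Ix i)) \<noteq> 0"
  shows "B X X > 0"
proof -
  define c where "c = (\<chi> j. coord (Ix j) X)"
  have Gc: "(\<chi> i j. B (F (Ix i)) (F (Ix j))) *v c = (\<chi> i. B X (F (Ix i)))"
    using B_coord(4)[of X] by (simp add: vec_eq_iff matrix_vector_mult_def c_def)
  have "coord IxN X = 0" "coord IxN1 X = 0"
    using B_coord(1,3)[of X] assms(1,2) by auto
  then have X: "X = coord Ix0 X *\<^sub>R F Ix0 + (\<Sum>i\<in>UNIV. c $ i *\<^sub>R F (Ix i))"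
    using coord_expand[of X] unfolding sum_frame_index by (simp add: c_def)
  have "B X X = B (coord Ix0 X *\<^sub>R F Ix0 + (\<Sum>i\<in>UNIV. c $ i *\<^sub>R F (Ix i))) X"
    using X by (rule arg_cong)
  also have "\<dots> = c \<bullet> ((\<chi> i j. B (F (Ix i)) (F (Ix j))) *v c)"
    using assms(1) by (simp add: B_simps B_sum_right sym[of _ X] inner_vec_def Gc)
  also have "c \<noteq> 0"
    using fun_cong[OF arg_cong[OF Gc, of vec_nth], of i] assms(3) by auto
  then have "c \<bullet> ((\<chi> i j. B (F (Ix i)) (F (Ix j))) *v c) > 0" by (rule posdef)
  finally show ?thesis .
qed

text \<open>Used to prove vector equations by comparing products with all frame vectors.\<close>

lemma nondegenerate: "(\<And>\<xi>. B X (F \<xi>) = 0) \<Longrightarrow> X = 0"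
proof -
  assume *: "\<And>\<xi>. B X (F \<xi>) = 0"
  define c where "c = (\<chi> j. coord (Ix j) X)"
  have "(\<chi> i j. B (F (Ix i)) (F (Ix j))) *v c = 0"
    using B_coord(4)[of X] * by (simp add: vec_eq_iff matrix_vector_mult_def c_def)
  then have "c = 0" using posdef[of c] by auto
  then have "coord (Ix j) X = 0" for j by (simp add: c_def vec_eq_iff)
  moreover have "coord Ix0 X = 0" "coord IxN X = 0" "coord IxN1 X = 0"
    using B_coord(1-3)[of X] * by auto
  ultimately have "coord \<xi> X = 0" for \<xi> by (cases \<xi>) auto
  then show "X = 0" using coord_expand[of X] by simp
qed

end

section \<open>Connection forms and basis forms along a hypersurface\<close>

locale framed_hypersurface = bilinear_space B for B :: "'v::euclidean_space \<Rightarrow> 'v \<Rightarrow> real" +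
  fixes U :: "(real^'i::finite) set" and x :: "real^'i \<Rightarrow> 'v" and A :: "('i, 'v) frame_field"
  assumes dim: "DIM('v) = CARD('i) + 3"
    and hypersurface: "hypersurface B U x" and frame: "conformal_frame B U x A"
begin

lemma frame_at: "u \<in> U \<Longrightarrow> frame_at B (\<lambda>\<xi>. A \<xi> u)"
  using frame dim unfolding conformal_frame_def metric_def
  by unfold_locales auto

lemma open_U: "open U" using hypersurface by (simp add: hypersurface_def)

lemma smooth_A: "smooth_map_on U (A \<xi>)" using frame by (simp add: conformal_frame_def)

lemma smooth_x: "smooth_map_on U x" using hypersurface by (simp add: hypersurface_def)

lemma diff_A: "u \<in> U \<Longrightarrow> A \<xi> differentiable at u"
  using smooth_map_on_has_derivative[OF smooth_A] by (auto simp: differentiable_def)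

lemma diff_x: "u \<in> U \<Longrightarrow> x differentiable at u"
  using smooth_map_on_has_derivative[OF smooth_x] by (auto simp: differentiable_def)

lemma A0: "u \<in> U \<Longrightarrow> A Ix0 u = x u" using frame by (simp add: conformal_frame_def)

lemma deriv_A0: "u \<in> U \<Longrightarrow> deriv_along (A Ix0) u h = deriv_along x u h"
  using frechet_derivative_transform_within_open[OF diff_A open_U] A0 by metis

lemmas linear_A = smooth_map_on_linear[OF smooth_A]

lemmas frame_gram = frame_at.gram[OF frame_at] frame_at.gram_sym[OF frame_at]

lemma B_deriv_x:
  assumes "u \<in> U"
  shows "B (deriv_along x u h) (A IxN u) = 0" "B (deriv_along x u h) (x u) = 0"
proof -
  show "B (deriv_along x u h) (A IxN u) = 0"
    using frame assms by (simp add: conformal_frame_def tangent_to_direction_def)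
  have "B (x w) (x w) = 0" if "w \<in> U" for w
    using frame_gram(1)[OF that] by (simp add: A0[OF that])
  from deriv_B_const[OF open_U assms diff_x[OF assms] diff_x[OF assms] this, of h]
  show "B (deriv_along x u h) (x u) = 0" by (simp add: sym)
qed

lemma metric_nth: "metric B A u $ i $ j = B (A (Ix i) u) (A (Ix j) u)"
  by (simp add: metric_def)

lemma metric_sym: "metric B A u $ i $ j = metric B A u $ j $ i"
  by (simp add: metric_nth sym)

lemma metric_pos: "u \<in> U \<Longrightarrow> c \<noteq> 0 \<Longrightarrow> c \<bullet> (metric B A u *v c) > 0"
  using frame by (simp add: conformal_frame_def)

lemma det_metric: "u \<in> U \<Longrightarrow> det (metric B A u) \<noteq> 0"
  using metric_pos by (intro det_nonzeroI) force

lemma metric_inv: "u \<in> U \<Longrightarrow> metric B A u ** matrix_inv (metric B A u) = mat 1"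
  "u \<in> U \<Longrightarrow> matrix_inv (metric B A u) ** metric B A u = mat 1"
  using det_metric[of u] someI_ex[of "\<lambda>N. metric B A u ** N = mat 1 \<and> N ** metric B A u = mat 1"]
  unfolding invertible_det_nz[symmetric] invertible_def matrix_inv_def by blast+

lemma metric_diag_pos: "u \<in> U \<Longrightarrow> metric B A u $ i $ i > 0"
  using metric_pos[of u "axis i 1"] by (simp add: matrix_vector_mult_basis inner_axis' column_def axis_eq_0_iff)

lemma B_deriv_x_A:
  "u \<in> U \<Longrightarrow> B (deriv_along x u h) (A (Ix i) u) = (metric B A u *v coframe A u h) $ i"
  using frame_at.B_coord(4)[OF frame_at, of u "deriv_along x u h" i]
  by (simp add: coframe_def conn_def deriv_A0 metric_def matrix_vector_mult_def)

text \<open>The component along \<open>A IxN\<close> vanishes because \<open>A IxN\<close> is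
  tangent to the hypersurface, the one along \<open>A IxN1\<close> because \<open>x\<close> stays
  isotropic.\<close>

lemma deriv_x_expand:
  assumes "u \<in> U"
  shows "deriv_along x u h = conn A Ix0 Ix0 u h *\<^sub>R x u + (\<Sum>i\<in>UNIV. coframe A u h $ i *\<^sub>R A (Ix i) u)"
proof -
  have "conn A Ix0 IxN u h = 0" "conn A Ix0 IxN1 u h = 0"
    using frame_at.B_coord(1,3)[OF frame_at[OF assms], of "deriv_along x u h"] B_deriv_x[OF assms, of h]
    by (simp_all add: conn_def deriv_A0[OF assms] A0[OF assms])
  then show ?thesis
    using frame_at.coord_expand[OF frame_at[OF assms], of "deriv_along x u h"]
    unfolding sum_frame_index
    by (simp add: conn_def deriv_A0[OF assms] coframe_def A0[OF assms])
qed

lemma conn_eqs: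
  assumes "u \<in> U"
  shows "conn A \<xi> Ix0 u h = - B (deriv_along (A \<xi>) u h) (A IxN1 u)"
    "conn A \<xi> IxN u h = B (deriv_along (A \<xi>) u h) (A IxN u)"
    "conn A \<xi> IxN1 u h = - B (deriv_along (A \<xi>) u h) (x u)"
    "(\<Sum>j\<in>UNIV. metric B A u $ i $ j * conn A \<xi> (Ix j) u h) = B (deriv_along (A \<xi>) u h) (A (Ix i) u)"
  using frame_at.B_coord[OF frame_at[OF assms], of "deriv_along (A \<xi>) u h"]
  by (simp_all add: conn_def A0[OF assms] metric_nth)

lemma linear_conn: "u \<in> U \<Longrightarrow> linear (conn A \<xi> \<eta> u)"
  using linear_compose[OF linear_A[of u \<xi>] frame_at.linear_coord[OF frame_at[of u], of \<eta>]]
  by (simp add: conn_def[abs_def] o_def)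

lemma linear_coframe:
  assumes "u \<in> U" shows "linear (coframe A u)"
proof -
  have "linear (\<lambda>h. conn A Ix0 (Ix i) u h)" for i by (rule linear_conn[OF assms])
  then show ?thesis
    unfolding linear_iff coframe_def by (simp add: vec_eq_iff)
qed

text \<open>If all basis forms vanish on \<open>h\<close>, then the derivative of \<open>x\<close>
  along \<open>h\<close> is a multiple of \<open>x u\<close>, and the immersion condition gives
  \<open>h = 0\<close>.\<close>

lemma bij_coframe:
  assumes "u \<in> U" shows "bij (coframe A u)"
proof -
  have "h = 0" if "coframe A u h = 0" for h
    using deriv_x_expand[OF assms, of h] hypersurface assms that
    by (auto simp: hypersurface_def)
  then have "inj (coframe A u)"
    using linear_injective_0[OF linear_coframe[OF assms]] by blast
  then show ?thesis
    using linear_injective_imp_surjective[OF linear_coframe[OF assms]] by (simp add: bij_def)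
qed

lemma coframe_surj:
  assumes "u \<in> U" obtains h where "coframe A u h = c"
  using bij_is_surj[OF bij_coframe[OF assms]] by (metis surjD)

text \<open>The vectors \<open>e k\<close> dual to the basis forms give existence and uniqueness of
  the coefficients, so the definite description in \<open>form_coeffs\<close> denotes them.\<close>

lemma form_coeffs:
  assumes "u \<in> U" "linear \<alpha>"
  shows "\<alpha> h = (\<Sum>k\<in>UNIV. form_coeffs A u \<alpha> $ k * coframe A u h $ k)"
proof -
  define e where "e k = inv (coframe A u) (axis k 1)" for k
  have e: "coframe A u (e k) = axis k 1" for k
    unfolding e_def using bij_is_surj[OF bij_coframe[OF assms(1)]] by (rule surj_f_inv_f)
  have h: "h = (\<Sum>k\<in>UNIV. coframe A u h $ k *\<^sub>R e k)" for h
  proof (rule injD[OF bij_is_inj[OF bij_coframe[OF assms(1)]]])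
    show "coframe A u h = coframe A u (\<Sum>k\<in>UNIV. coframe A u h $ k *\<^sub>R e k)"
      by (simp add: linear_sum[OF linear_coframe[OF assms(1)]] linear_scale[OF linear_coframe[OF assms(1)]] e
          vec_eq_iff sum_component axis_def if_distrib sum.delta cong: if_cong)
  qed
  have "form_coeffs A u \<alpha> = (\<chi> k. \<alpha> (e k))"
    unfolding form_coeffs_def
  proof (rule the_equality)
    show "\<forall>h. \<alpha> h = (\<Sum>k\<in>UNIV. (\<chi> k. \<alpha> (e k)) $ k * coframe A u h $ k)"
      by (subst h) (simp add: linear_sum[OF assms(2)] linear_scale[OF assms(2)] mult.commute)
    fix c assume "\<forall>h. \<alpha> h = (\<Sum>k\<in>UNIV. c $ k * coframe A u h $ k)"
    then have "\<alpha> (e k) = c $ k" for k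
      by (simp add: e axis_def if_distrib sum.delta cong: if_cong)
    then show "c = (\<chi> k. \<alpha> (e k))" by (simp add: vec_eq_iff)
  qed
  then show ?thesis
    by (subst h) (simp add: linear_sum[OF assms(2)] linear_scale[OF assms(2)] mult.commute)
qed

section \<open>The second fundamental form and its symmetry\<close>

lemma lambda2:
  assumes "u \<in> U"
  shows "B (deriv_along (A (Ix i)) u h) (A IxN u) = (lambda2 A u *v coframe A u h) $ i"
  using form_coeffs[OF assms linear_conn[OF assms], of "Ix i" IxN h]
  by (simp add: conn_eqs(2)[OF assms] lambda2_def matrix_vector_mult_def)

lemma B_A_deriv_An:
  assumes "u \<in> U"
  shows "B (A (Ix i) u) (deriv_along (A IxN) u h) = - (lambda2 A u *v coframe A u h) $ i"
  using deriv_B_const[OF open_U assms diff_A[OF assms] diff_A[OF assms], of "Ix i" IxN 0 h] frame_gram(7) lambda2[OF assms]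
  by simp

lemma B_deriv_An:
  assumes "u \<in> U"
  shows "B (deriv_along (A IxN) u h) (x u) = 0" "B (deriv_along (A IxN) u h) (A IxN u) = 0"
proof -
  have "B (x w) (A IxN w) = 0" if "w \<in> U" for w using frame_gram(4)[OF that] by (simp add: A0[OF that])
  from deriv_B_const[OF open_U assms diff_x[OF assms] diff_A[OF assms] this, of h]
  show "B (deriv_along (A IxN) u h) (x u) = 0" using B_deriv_x(1)[OF assms, of h] by (simp add: sym)
  show "B (deriv_along (A IxN) u h) (A IxN u) = 0"
    using deriv_B_const[OF open_U assms diff_A[OF assms] diff_A[OF assms] frame_gram(8), of h]
    by (simp add: sym)
qed

lemma B_deriv_x_deriv_An:
  assumes "u \<in> U"
  shows "B (deriv_along x u h) (deriv_along (A IxN) u k) = - (coframe A u h \<bullet> (lambda2 A u *v coframe A u k))"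
proof -
  have "B (x u) (deriv_along (A IxN) u k) = 0" using B_deriv_An(1)[OF assms, of k] by (simp add: sym)
  then show ?thesis
    by (simp add: deriv_x_expand[OF assms, of h] B_simps B_sum_left B_A_deriv_An[OF assms] inner_vec_def sum_negf)
qed

text \<open>The symmetry of \<open>\<lambda>\<^sub>i\<^sub>j\<close> is that of the second derivative of \<open>x\<close>: the normal component of the
  latter is the second fundamental form.\<close>

lemma lambda2_sym:
  assumes "u \<in> U"
  shows "lambda2 A u $ i $ j = lambda2 A u $ j $ i"
proof -
  have II: "B (deriv_along x u h) (deriv_along (A IxN) u k) = B (deriv_along x u k) (deriv_along (A IxN) u h)" for h k
  proof -
    \<comment> \<open>The normal vector is frozen at \<open>u\<close>. The second derivatives of
      \<open>f\<close> at \<open>u\<close> are then the normal components of those of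
      \<open>x\<close>, and the symmetry for real-valued functions applies.\<close>
    define f where "f w = B (x w) (A IxN u)" for w
    have blin: "bounded_linear (\<lambda>X. B X (A IxN u))"
      using bounded_bilinear.bounded_linear_left[OF bounded_bilinear_B] .
    have C2: "Ck_on 2 U f"
      unfolding f_def[abs_def] using smooth_x unfolding smooth_map_on_def
      by (blast intro: Ck_on_bounded_linear[OF open_U blin])
    have df: "deriv_along f w h = B (deriv_along x w h) (A IxN u)" if "w \<in> U" for w h
      unfolding f_def[abs_def]
      using frechet_derivative_eqI[OF bounded_linear.has_derivative[OF blin smooth_map_on_has_derivative[OF smooth_x that]]]
      by simp
    have ddf: "deriv_along (\<lambda>w. deriv_along f w h) u k = B (deriv_along (\<lambda>w. deriv_along x w h) u k) (A IxN u)" for h k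
    proof -
      have "((\<lambda>w. B (deriv_along x w h) (A IxN u)) has_derivative
          (\<lambda>k. B (deriv_along (\<lambda>w. deriv_along x w h) u k) (A IxN u))) (at u)"
        by (rule bounded_linear.has_derivative[OF blin
              smooth_map_on_has_derivative[OF smooth_map_on_deriv[OF smooth_x] assms]])
      then have "((\<lambda>w. deriv_along f w h) has_derivative
          (\<lambda>k. B (deriv_along (\<lambda>w. deriv_along x w h) u k) (A IxN u))) (at u)"
        by (rule has_derivative_transform_within_open[OF _ open_U assms]) (simp add: df)
      then show ?thesis by (simp add: frechet_derivative_eqI)
    qed
    have dif: "(\<lambda>w. deriv_along x w h) differentiable at u" for h
      using smooth_map_on_has_derivative[OF smooth_map_on_deriv[OF smooth_x] assms]
      by (auto simp: differentiable_def)
    \<comment> \<open>Obtained by differentiating the orthogonality of \<open>A IxN\<close> to the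
      tangent vector \<open>deriv_along x w h\<close> in direction \<open>k\<close>.\<close>
    have "B (deriv_along x u h) (deriv_along (A IxN) u k) = - deriv_along (\<lambda>w. deriv_along f w h) u k" for h k
      using deriv_B_const[OF open_U assms dif diff_A[OF assms] B_deriv_x(1), of h k] by (simp add: ddf)
    then show ?thesis
      using second_derivative_symmetric_real[OF open_U C2 assms] by metis
  qed
  obtain h k where "coframe A u h = axis i 1" "coframe A u k = axis j 1"
    by (metis coframe_surj[OF assms])
  then show ?thesis
    using II[of h k] by (simp add: B_deriv_x_deriv_An[OF assms] inner_axis' matrix_vector_mult_basis column_def)
qed

section \<open>Smoothness of the basis forms and of the second fundamental form\<close>

lemma smooth_coframe: "smooth_map_on U (\<lambda>u. coframe A u h)"
proof -
  have "Ck_on k U (\<lambda>u. coframe A u h)" for k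
  \<comment> \<open>The components solve the system with matrix \<open>metric\<close> whose
    right-hand side consists of products of smooth vector fields; this avoids differentiating
    \<open>representation\<close>.\<close>
  proof (rule Ck_on_linear_system[OF open_U])
    show "Ck_on k U (\<lambda>u. metric B A u $ i $ j)" for i j
      unfolding metric_nth using smooth_B[OF open_U smooth_A smooth_A] unfolding smooth_map_on_def by blast
    show "Ck_on k U (\<lambda>u. B (deriv_along x u h) (A (Ix i) u))" for i
      using smooth_B[OF open_U smooth_map_on_deriv[OF smooth_x] smooth_A] unfolding smooth_map_on_def by blast
    fix u assume u: "u \<in> U"
    show "det (\<chi> i j. metric B A u $ i $ j) \<noteq> 0" using det_metric[OF u] by simp
    show "(\<chi> i j. metric B A u $ i $ j) *v coframe A u h = (\<chi> i. B (deriv_along x u h) (A (Ix i) u))"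
      using B_deriv_x_A[OF u] by (simp add: vec_eq_iff)
  qed
  then show ?thesis unfolding smooth_map_on_def by blast
qed

text \<open>On the coordinate vectors \<open>axis j 1\<close> the defining equation becomes a linear
  system for row \<open>i\<close>. Its matrix is nonsingular because the values of
  \<open>coframe\<close> on these vectors span the whole space.\<close>

lemma smooth_lambda2: "smooth_map_on U (\<lambda>u. lambda2 A u $ i $ j)"
proof -
  have "Ck_on k U (\<lambda>u. lambda2 A u $ i)" for k
  proof (rule Ck_on_linear_system[OF open_U])
    show "Ck_on k U (\<lambda>u. coframe A u (axis j 1) $ l)" for j l
      using Ck_on_bounded_linear[OF open_U bounded_linear_vec_nth] smooth_coframe
      unfolding smooth_map_on_def by blast
    show "Ck_on k U (\<lambda>u. B (deriv_along (A (Ix i)) u (axis j 1)) (A IxN u))" for j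
      using smooth_B[OF open_U smooth_map_on_deriv[OF smooth_A] smooth_A] unfolding smooth_map_on_def by blast
    fix u assume u: "u \<in> U"
    show "(\<chi> j l. coframe A u (axis j 1) $ l) *v lambda2 A u $ i =
        (\<chi> j. B (deriv_along (A (Ix i)) u (axis j 1)) (A IxN u))"
      by (simp add: vec_eq_iff lambda2[OF u] matrix_vector_mult_def mult.commute)
    show "det (\<chi> j l. coframe A u (axis j 1) $ l) \<noteq> 0"
    proof (rule det_nonzeroI)
      fix c assume *: "(\<chi> j l. coframe A u (axis j 1) $ l) *v c = 0"
      have 0: "coframe A u (axis j 1) \<bullet> c = 0" for j
        using fun_cong[OF arg_cong[OF *, of vec_nth], of j]
        by (simp add: matrix_vector_mult_def inner_vec_def)
      have "h = (\<Sum>j\<in>UNIV. h $ j *\<^sub>R axis j 1)" for h :: "real^'i"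
        by (simp add: vec_eq_iff sum_component axis_def if_distrib sum.delta cong: if_cong)
      then have e: "coframe A u h = (\<Sum>j\<in>UNIV. h $ j *\<^sub>R coframe A u (axis j 1))" for h
        by (subst linear_sum[OF linear_coframe[OF u], of "\<lambda>j. h $ j *\<^sub>R axis j 1", symmetric, unfolded linear_scale[OF linear_coframe[OF u]]]) simp
      have "coframe A u h \<bullet> c = 0" for h
        unfolding e[of h] by (simp add: inner_sum_left 0)
      moreover obtain h where "coframe A u h = c" by (rule coframe_surj[OF u])
      ultimately show "c = 0" by (metis inner_eq_zero_iff)
    qed
  qed
  then show ?thesis
    using Ck_on_bounded_linear[OF open_U bounded_linear_vec_nth] unfolding smooth_map_on_def by blast
qed

text \<open>To apply \<open>form_coeffs\<close>, the right-hand side must be linear in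
  \<open>h\<close>; for the derivative of \<open>lambda2\<close> this comes from its
  smoothness.\<close>

lemma lambda3:
  assumes "u \<in> U"
  shows "(\<Sum>k\<in>UNIV. lambda3 B A u i j k * coframe A u h $ k) =
         deriv_along (\<lambda>w. lambda2 A w $ i $ j) u h
       - (\<Sum>l\<in>UNIV. lambda2 A u $ l $ j * conn A (Ix i) (Ix l) u h)
       - (\<Sum>l\<in>UNIV. lambda2 A u $ i $ l * conn A (Ix j) (Ix l) u h)
       + lambda2 A u $ i $ j * conn A Ix0 Ix0 u h
       + metric B A u $ i $ j * conn A IxN Ix0 u h"
  unfolding lambda3_def
proof (rule form_coeffs[OF assms, symmetric])
  note lin = linear_conn[OF assms] smooth_map_on_linear[OF smooth_lambda2 assms]
  show "linear (\<lambda>h. deriv_along (\<lambda>w. lambda2 A w $ i $ j) u h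
       - (\<Sum>l\<in>UNIV. lambda2 A u $ l $ j * conn A (Ix i) (Ix l) u h)
       - (\<Sum>l\<in>UNIV. lambda2 A u $ i $ l * conn A (Ix j) (Ix l) u h)
       + lambda2 A u $ i $ j * conn A Ix0 Ix0 u h
       + metric B A u $ i $ j * conn A IxN Ix0 u h)"
    by (rule linearI)
       (simp_all add: linear_add[OF lin(1)] linear_add[OF lin(2)] linear_scale[OF lin(1)] linear_scale[OF lin(2)]
         sum.distrib sum_distrib_left algebra_simps)
qed

end

section \<open>The principal hypersphere of an adapted frame\<close>

lemma sum_option:
  fixes f :: "'p::finite option \<Rightarrow> 'a::comm_monoid_add"
  shows "sum f UNIV = f None + (\<Sum>p\<in>UNIV. f (Some p))"
  by (simp add: UNIV_option_conv sum.reindex)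

locale adapted_hypersurface = framed_hypersurface B U x A
  for B :: "'v::euclidean_space \<Rightarrow> 'v \<Rightarrow> real" and U :: "(real^('p::finite option)) set" and x A +
  fixes s :: "real^('p option) \<Rightarrow> real"
  assumes adapted: "adapted_frame B U A s"
begin

lemma metric_None_Some: "u \<in> U \<Longrightarrow> metric B A u $ None $ Some p = 0"
  using adapted by (simp add: adapted_frame_def)

lemma eigendirection_eq:
  "u \<in> U \<Longrightarrow> eigendirection B A s u = {h. \<forall>p. coframe A u h $ Some p = 0}"
  using adapted by (simp add: adapted_frame_def)

text \<open>The quotient is visibly smooth, while \<open>s\<close> is given only pointwise;
  \<open>curv_eq\<close> identifies it with \<open>lambda0 + s\<close>.\<close>

definition curv :: "real^('p option) \<Rightarrow> real" where
  "curv u = lambda2 A u $ None $ None / metric B A u $ None $ None"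

text \<open>By \<open>B_deriv_curv_sphere\<close> this matrix gives the products of the derivative
  of \<open>curv_sphere\<close> with the vectors \<open>A (Ix i)\<close>.\<close>

definition pencil :: "real^('p option) \<Rightarrow> real^('p option)^('p option)" where
  "pencil u = curv u *\<^sub>R metric B A u - lambda2 A u"

text \<open>The hypersphere tangent at \<open>x u\<close> with the principal curvature of the eigendirection.\<close>

definition curv_sphere :: "real^('p option) \<Rightarrow> 'v" where
  "curv_sphere u = A IxN u + curv u *\<^sub>R x u"

text \<open>Multiplication by the invertible metric lowers the index of the affinor.\<close>

lemma a2_eigen_iff:
  assumes "u \<in> U"
  shows "burali_forti B A u *v c = s u *\<^sub>R c \<longleftrightarrow> a2 B A u *v c = s u *\<^sub>R (metric B A u *v c)"
proof
  assume "burali_forti B A u *v c = s u *\<^sub>R c"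
  then have "metric B A u *v (matrix_inv (metric B A u) *v (a2 B A u *v c)) = s u *\<^sub>R (metric B A u *v c)"
    by (simp add: burali_forti_def matrix_vector_mul_assoc[symmetric] matrix_vector_mult_scaleR)
  then show "a2 B A u *v c = s u *\<^sub>R (metric B A u *v c)"
    by (simp add: matrix_vector_mul_assoc matrix_mul_assoc metric_inv[OF assms])
next
  assume *: "a2 B A u *v c = s u *\<^sub>R (metric B A u *v c)"
  have "burali_forti B A u *v c = matrix_inv (metric B A u) *v (a2 B A u *v c)"
    by (simp add: burali_forti_def matrix_vector_mul_assoc)
  also have "\<dots> = s u *\<^sub>R c"
    by (simp add: * matrix_vector_mult_scaleR matrix_vector_mul_assoc metric_inv[OF assms])
  finally show "burali_forti B A u *v c = s u *\<^sub>R c" .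
qed

text \<open>In an adapted frame \<open>axis None 1\<close> is an eigenvector of the affinor, so the
  \<open>None\<close> columns of \<open>a2\<close> and \<open>metric\<close> are proportional with
  factor \<open>s u\<close>. Adding the trace part turns this factor into
  \<open>curv u\<close>.\<close>

lemma curv_eq:
  assumes "u \<in> U"
  shows "curv u = lambda0 B A u + s u" "lambda2 A u $ i $ None = curv u * metric B A u $ i $ None"
proof -
  obtain h where h: "coframe A u h = axis None 1" by (rule coframe_surj[OF assms])
  then have "h \<in> eigendirection B A s u" by (simp add: eigendirection_eq[OF assms] axis_def)
  then have "a2 B A u *v axis None 1 = s u *\<^sub>R (metric B A u *v axis None 1)"
    using a2_eigen_iff[OF assms, of "axis None 1"] by (simp add: eigendirection_def h)
  then have "a2 B A u $ i $ None = s u * metric B A u $ i $ None" for i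
    by (simp add: vec_eq_iff matrix_vector_mult_basis column_def)
  then have *: "lambda2 A u $ i $ None = (lambda0 B A u + s u) * metric B A u $ i $ None" for i
    by (simp add: a2_def algebra_simps)
  then show "curv u = lambda0 B A u + s u"
    using metric_diag_pos[OF assms, of None] by (simp add: curv_def)
  then show "lambda2 A u $ i $ None = curv u * metric B A u $ i $ None" by (simp add: *)
qed

lemma lambda2_None:
  assumes "u \<in> U"
  shows "lambda2 A u $ None $ None = curv u * metric B A u $ None $ None"
    "lambda2 A u $ Some p $ None = 0" "lambda2 A u $ None $ Some p = 0"
proof -
  show "lambda2 A u $ None $ None = curv u * metric B A u $ None $ None" by (rule curv_eq(2)[OF assms])
  show "lambda2 A u $ Some p $ None = 0"
    using metric_sym[of u "Some p" None] metric_None_Some[OF assms] by (simp add: curv_eq(2)[OF assms])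
  then show "lambda2 A u $ None $ Some p = 0" by (simp add: lambda2_sym[OF assms, of None])
qed

lemma a2_None_Some: "u \<in> U \<Longrightarrow> a2 B A u $ None $ Some p = 0"
  by (simp add: a2_def lambda2_None metric_None_Some)

text \<open>In the correction only the summand with \<open>l = None\<close> survives, and there both
  symmetrizations equal three times the product of the diagonal entries of \<open>a2\<close> and
  \<open>metric\<close>.\<close>

lemma a3_None: "u \<in> U \<Longrightarrow> a3 B A u None None None = lambda3 B A u None None None"
  by (simp add: a3_def Let_def sum_option a2_None_Some metric_None_Some)

lemma pencil_mult: "pencil u *v c = curv u *\<^sub>R (metric B A u *v c) - lambda2 A u *v c"
  unfolding pencil_def
  by (simp add: vec_eq_iff matrix_vector_mult_def algebra_simps sum_subtractf sum_distrib_left)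

lemma pencil_None: "u \<in> U \<Longrightarrow> (pencil u *v c) $ None = 0"
  by (simp add: pencil_def matrix_vector_mult_def sum_option lambda2_None metric_None_Some)

text \<open>Inserting \<open>curv = lambda0 + s\<close> cancels the trace part and leaves
  \<open>s g - a\<close>, whose kernel consists of the eigenvectors.\<close>

lemma pencil_kernel:
  assumes "u \<in> U"
  shows "pencil u *v coframe A u h = 0 \<longleftrightarrow> h \<in> eigendirection B A s u"
proof -
  have "pencil u *v c = s u *\<^sub>R (metric B A u *v c) - a2 B A u *v c" for c
    unfolding pencil_mult a2_def curv_eq(1)[OF assms]
    by (simp add: vec_eq_iff matrix_vector_mult_def algebra_simps sum_subtractf sum.distrib sum_distrib_left)
  then show ?thesis
    unfolding eigendirection_def mem_Collect_eq a2_eigen_iff[OF assms] by auto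
qed

lemma smooth_curv: "smooth_map_on U curv"
proof -
  have "Ck_on k U (\<lambda>u. lambda2 A u $ None $ None * inverse (metric B A u $ None $ None))" for k
  proof (intro Ck_on_bilinear[OF open_U bounded_bilinear_mult] Ck_on_inverse[OF open_U])
    show "Ck_on k U (\<lambda>u. lambda2 A u $ None $ None)"
      using smooth_lambda2 unfolding smooth_map_on_def by blast
    show "Ck_on k U (\<lambda>u. metric B A u $ None $ None)"
      unfolding metric_nth using smooth_B[OF open_U smooth_A smooth_A] unfolding smooth_map_on_def by blast
    show "metric B A u $ None $ None \<noteq> 0" if "u \<in> U" for u
      using metric_diag_pos[OF that, of None] by simp
  qed
  then show ?thesis unfolding smooth_map_on_def curv_def[abs_def] divide_inverse by blast
qed

lemma smooth_curv_sphere: "smooth_map_on U curv_sphere"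
  unfolding smooth_map_on_def curv_sphere_def[abs_def]
  using smooth_curv smooth_A smooth_x unfolding smooth_map_on_def
  by (intro allI Ck_on_add[OF open_U] Ck_on_bilinear[OF open_U bounded_bilinear_scaleR]) auto

lemmas linear_curv_sphere = smooth_map_on_linear[OF smooth_curv_sphere]

lemma deriv_curv_sphere:
  assumes "u \<in> U"
  shows "deriv_along curv_sphere u h
    = deriv_along (A IxN) u h + (curv u *\<^sub>R deriv_along x u h + deriv_along curv u h *\<^sub>R x u)"
  unfolding curv_sphere_def[abs_def]
  by (rule fun_cong[OF frechet_derivative_eqI[OF has_derivative_add[OF _ has_derivative_scaleR]]])
     (rule smooth_map_on_has_derivative[OF smooth_A assms] smooth_map_on_has_derivative[OF smooth_x assms]
        smooth_map_on_has_derivative[OF smooth_curv assms])+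

lemma B_curv_sphere:
  assumes "u \<in> U"
  shows "B (x u) (curv_sphere u) = 0" "B (deriv_along x u h) (curv_sphere u) = 0" "B (curv_sphere u) (curv_sphere u) = 1"
  using frame_gram[OF assms] B_deriv_x[OF assms, of h]
  by (simp_all add: curv_sphere_def B_simps A0[OF assms] sym[of "A IxN u" "x u"])

lemma B_deriv_curv_sphere:
  assumes "u \<in> U"
  shows "B (deriv_along curv_sphere u h) (x u) = 0" "B (deriv_along curv_sphere u h) (A IxN u) = 0"
    "B (deriv_along curv_sphere u h) (curv_sphere u) = 0"
    "B (deriv_along curv_sphere u h) (A (Ix i) u) = (pencil u *v coframe A u h) $ i"
proof -
  note * = B_deriv_x[OF assms] B_deriv_An[OF assms] frame_gram[OF assms, unfolded A0[OF assms]]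
  show "B (deriv_along curv_sphere u h) (x u) = 0" "B (deriv_along curv_sphere u h) (A IxN u) = 0"
    by (simp_all add: deriv_curv_sphere[OF assms] B_simps *)
  then show "B (deriv_along curv_sphere u h) (curv_sphere u) = 0"
    by (simp add: curv_sphere_def B_simps)
  show "B (deriv_along curv_sphere u h) (A (Ix i) u) = (pencil u *v coframe A u h) $ i"
    using B_A_deriv_An[OF assms, of i h]
    by (simp add: deriv_curv_sphere[OF assms] B_simps * B_deriv_x_A[OF assms] sym[of "deriv_along (A IxN) u h" "A (Ix i) u"] pencil_mult)
qed

text \<open>Here \<open>lambda2\<close> is \<open>curv\<close> times \<open>metric\<close> in the
  \<open>None\<close> entry, near \<open>u\<close> and not only at \<open>u\<close>, so it can be
  differentiated. The derivative of the metric entry contributes twice the form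
  \<open>conn A (Ix None) (Ix None)\<close>, which cancels the two connection terms of
  \<open>lambda3\<close>; the mixed entries vanish.\<close>

lemma lambda3_None:
  assumes "u \<in> U" and h: "coframe A u h = axis None 1"
  shows "lambda3 B A u None None None
    = metric B A u $ None $ None * (deriv_along curv u h + curv u * conn A Ix0 Ix0 u h + conn A IxN Ix0 u h)"
proof -
  let ?g = "\<lambda>u. metric B A u $ None $ None"
  have sm: "smooth_map_on U ?g"
    unfolding metric_nth by (rule smooth_B[OF open_U smooth_A smooth_A])
  have "B (deriv_along (A (Ix None)) u h) (A (Ix None) u) = ?g u * conn A (Ix None) (Ix None) u h"
    using conn_eqs(4)[OF assms(1), of None "Ix None" h] by (simp add: sum_option metric_None_Some[OF assms(1)])
  then have dg: "deriv_along ?g u h = 2 * ?g u * conn A (Ix None) (Ix None) u h"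
    unfolding metric_nth by (simp add: deriv_B[OF diff_A[OF assms(1)] diff_A[OF assms(1)]] sym)
  have "((\<lambda>w. curv w * ?g w) has_derivative
      (\<lambda>h. curv u * deriv_along ?g u h + deriv_along curv u h * ?g u)) (at u)"
    by (intro has_derivative_mult smooth_map_on_has_derivative[OF smooth_curv assms(1)]
        smooth_map_on_has_derivative[OF sm assms(1)])
  then have "((\<lambda>w. lambda2 A w $ None $ None) has_derivative
      (\<lambda>h. curv u * deriv_along ?g u h + deriv_along curv u h * ?g u)) (at u)"
    by (rule has_derivative_transform_within_open[OF _ open_U assms(1)]) (simp add: lambda2_None)
  then have dl: "deriv_along (\<lambda>w. lambda2 A w $ None $ None) u h
      = curv u * deriv_along ?g u h + deriv_along curv u h * ?g u"
    by (simp add: frechet_derivative_eqI)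
  have "(\<Sum>k\<in>UNIV. lambda3 B A u None None k * coframe A u h $ k) = lambda3 B A u None None None"
    by (simp add: h axis_def if_distrib sum.delta cong: if_cong)
  then show ?thesis
    unfolding lambda3[OF assms(1)] by (simp add: sum_option lambda2_None[OF assms(1)] dl dg algebra_simps)
qed

text \<open>The products of the derivative with \<open>x\<close>, with \<open>A IxN\<close> and, by
  \<open>pencil_kernel\<close>, with all \<open>A (Ix i)\<close> vanish. What remains is a multiple
  of \<open>x u\<close>, and \<open>lambda3_None\<close> identifies its factor.\<close>

lemma deriv_curv_sphere_eigen:
  assumes "u \<in> U" and h: "coframe A u h = axis None 1"
  shows "deriv_along curv_sphere u h = (a3 B A u None None None / metric B A u $ None $ None) *\<^sub>R x u"
proof -
  define \<kappa> where "\<kappa> = a3 B A u None None None / metric B A u $ None $ None"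
  have \<kappa>: "\<kappa> = deriv_along curv u h + curv u * conn A Ix0 Ix0 u h + conn A IxN Ix0 u h"
    unfolding \<kappa>_def a3_None[OF assms(1)] lambda3_None[OF assms]
    using metric_diag_pos[OF assms(1), of None] by simp
  note g = frame_gram[OF assms(1), unfolded A0[OF assms(1)]]
  have "h \<in> eigendirection B A s u" by (simp add: eigendirection_eq[OF assms(1)] h axis_def)
  then have p: "pencil u *v coframe A u h = 0" by (simp add: pencil_kernel[OF assms(1)])
  have "deriv_along curv_sphere u h - \<kappa> *\<^sub>R x u = 0"
  proof (rule frame_at.nondegenerate[OF frame_at[OF assms(1)]])
    fix \<xi> show "B (deriv_along curv_sphere u h - \<kappa> *\<^sub>R x u) (A \<xi> u) = 0"
    proof (cases \<xi>)
      case Ix0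
      then show ?thesis by (simp add: B_simps B_deriv_curv_sphere[OF assms(1)] g A0[OF assms(1)])
    next
      case (Ix i)
      then show ?thesis by (simp add: B_simps B_deriv_curv_sphere[OF assms(1)] g p)
    next
      case IxN
      then show ?thesis by (simp add: B_simps B_deriv_curv_sphere[OF assms(1)] g)
    next
      \<comment> \<open>The only frame vector not orthogonal to \<open>x u\<close>; the product is
        -1, and pairing with it extracts the \<open>Ix0\<close> connection coefficients with the
        same sign.\<close>
      case IxN1
      then show ?thesis
        using conn_eqs(1)[OF assms(1), of Ix0 h] conn_eqs(1)[OF assms(1), of IxN h]
        by (simp add: deriv_curv_sphere[OF assms(1)] B_simps g \<kappa> deriv_A0[OF assms(1)])
    qed
  qed
  then show ?thesis by (simp add: \<kappa>_def)
qed

section \<open>Canal hypersurfaces\<close>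

text \<open>Tangency in all directions makes \<open>Y\<close> orthogonal to \<open>x u\<close> and
  to every \<open>A (Ix i)\<close>; the orthogonal complement of these vectors is spanned by
  \<open>A IxN\<close> and \<open>x u\<close>.\<close>

lemma tangent_sphere_expand:
  assumes "u \<in> U" and tangent: "\<And>h. tangent_to_direction B x u h Y"
  shows "B Y (A (Ix i) u) = 0" "Y = B Y (A IxN u) *\<^sub>R A IxN u - B Y (A IxN1 u) *\<^sub>R x u"
proof -
  have xY: "B (x u) Y = 0" "B (deriv_along x u h) Y = 0" for h
    using tangent by (auto simp: tangent_to_direction_def)
  have *: "B Y (A (Ix i) u) = 0" for i
  proof -
    obtain h where "coframe A u h = axis i 1" by (rule coframe_surj[OF assms(1)])
    then have "deriv_along x u h = conn A Ix0 Ix0 u h *\<^sub>R x u + A (Ix i) u"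
      by (simp add: deriv_x_expand[OF assms(1), of h] axis_def if_distrib[of "\<lambda>t. t *\<^sub>R _"] sum.delta cong: if_cong)
    then show ?thesis using xY(2)[of h] xY(1) by (simp add: B_simps sym[of Y])
  qed
  then show "B Y (A (Ix i) u) = 0" .
  note g = frame_gram[OF assms(1), unfolded A0[OF assms(1)]]
  have "Y - (B Y (A IxN u) *\<^sub>R A IxN u - B Y (A IxN1 u) *\<^sub>R x u) = 0"
  proof (rule frame_at.nondegenerate[OF frame_at[OF assms(1)]])
    fix \<xi> show "B (Y - (B Y (A IxN u) *\<^sub>R A IxN u - B Y (A IxN1 u) *\<^sub>R x u)) (A \<xi> u) = 0"
      using xY(1) by (cases \<xi>) (simp_all add: B_simps g * A0[OF assms(1)] sym[of Y "x u"])
  qed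
  then show "Y = B Y (A IxN u) *\<^sub>R A IxN u - B Y (A IxN1 u) *\<^sub>R x u" by simp
qed

section \<open>Vanishing of the diagonal component on a canal hypersurface\<close>

lemma canal_imp_a3_zero:
  assumes canal: "one_canal_for B U x (eigendirection B A s)" and "u \<in> U"
  shows "a3 B A u None None None = 0"
proof -
  obtain U' W Y \<phi> where U': "open U'" "u \<in> U'" "U' \<subseteq> U" and fam: "sphere_family B W Y"
    and env: "envelope_of B U' x W Y \<phi>"
    and dir': "\<forall>u\<in>U'. \<forall>h\<in>eigendirection B A s u. \<forall>Z\<in>char_span Y (\<phi> u). tangent_to_direction B x u h Z"
    using bspec[OF canal[unfolded one_canal_for_def] assms(2)] by (elim exE conjE) (rule that)
  have dir: "tangent_to_direction B x w h Z"
    if "w \<in> U'" "h \<in> eigendirection B A s w" "Z \<in> char_span Y (\<phi> w)" for w h Z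
    using dir' that by simp
  \<comment> \<open>The component along \<open>A IxN\<close>; it turns out to be the ratio of the
    enveloping hypersphere to \<open>curv_sphere\<close>.\<close>
  define c where "c w = B (Y (\<phi> w)) (A IxN w)" for w
  have \<phi>W: "\<phi> w \<in> W" if "w \<in> U'" for w using env that by (auto simp: envelope_of_def)
  have tan: "tangent_to_direction B x w h (Y (\<phi> w))" if "w \<in> U'" for w h
    using env that by (auto simp: envelope_of_def)
  have char: "B (x w) X = 0" if "w \<in> U'" "X \<in> char_span Y (\<phi> w)" for w X
    using env that by (auto simp: envelope_of_def family_characteristic_def)
  have dY: "((\<lambda>w. Y (\<phi> w)) has_derivative (\<lambda>h. deriv_along Y (\<phi> w) (deriv_along \<phi> w h))) (at w)"
    if "w \<in> U'" for w
    using fam env that \<phi>W[OF that] unfolding sphere_family_def envelope_of_def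
    by (auto intro!: has_derivative_compose[where f = \<phi> and g = Y] smooth_map_on_has_derivative)
  have dYspan: "deriv_along (\<lambda>w. Y (\<phi> w)) w h \<in> char_span Y (\<phi> w)" if "w \<in> U'" for w h
    by (simp add: frechet_derivative_eqI[OF dY[OF that]] char_span_def span_base)
  have diffY: "(\<lambda>w. Y (\<phi> w)) differentiable at w" if "w \<in> U'" for w
    using dY[OF that] by (auto simp: differentiable_def)
  have c: "c w \<noteq> 0" and Yc: "Y (\<phi> w) = c w *\<^sub>R curv_sphere w" if w: "w \<in> U'" for w
  proof -
    have wU: "w \<in> U" using w U' by auto
    note g = frame_gram[OF wU, unfolded A0[OF wU]]
    define d where "d = - B (Y (\<phi> w)) (A IxN1 w)"
    have Y: "Y (\<phi> w) = c w *\<^sub>R A IxN w + d *\<^sub>R x w"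
      using tangent_sphere_expand(2)[OF wU tan[OF w]] by (simp add: c_def d_def)
    have "B (Y (\<phi> w)) (Y (\<phi> w)) > 0"
      using fam \<phi>W[OF w] by (auto simp: sphere_family_def is_hypersphere_def)
    \<comment> \<open>Since \<open>x w\<close> is isotropic and orthogonal to
      \<open>A IxN w\<close>, the positive square of the hypersphere is that of
      \<open>c w\<close>.\<close>
    then show "c w \<noteq> 0" by (auto simp: Y B_simps g)
    obtain h where h: "coframe A w h = axis None 1" by (rule coframe_surj[OF wU])
    then have "h \<in> eigendirection B A s w" by (simp add: eigendirection_eq[OF wU] axis_def)
    \<comment> \<open>The derivative of the enveloping hypersphere lies in the characteristic span,
      and the eigendirection is tangent to every hypersphere in that span.\<close>
    then have "B (deriv_along x w h) (deriv_along (\<lambda>w. Y (\<phi> w)) w h) = 0"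
      using dir[OF w] dYspan[OF w] by (auto simp: tangent_to_direction_def)
    moreover have "deriv_along x w h = conn A Ix0 Ix0 w h *\<^sub>R x w + A (Ix None) w"
      by (simp add: deriv_x_expand[OF wU, of h] h axis_def if_distrib[of "\<lambda>t. t *\<^sub>R _"] sum.delta cong: if_cong)
    ultimately have 1: "B (A (Ix None) w) (deriv_along (\<lambda>w. Y (\<phi> w)) w h) = 0"
      using char[OF w dYspan[OF w]] by (simp add: B_simps)
    \<comment> \<open>Differentiating this orthogonality along the eigendirection leaves one linear
      equation between \<open>c w\<close> and \<open>d\<close>, which fixes the member of the
      tangent pencil.\<close>
    have "B (A (Ix None) v) (Y (\<phi> v)) = 0" if "v \<in> U'" for v
      using tangent_sphere_expand(1)[OF _ tan[OF that]] that U' by (auto simp: sym)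
    from deriv_B_const[OF U'(1) w diff_A[OF wU] diffY[OF w] this, of h] 1
    have 2: "c w * B (deriv_along (A (Ix None)) w h) (A IxN w) + d * B (deriv_along (A (Ix None)) w h) (x w) = 0"
      by (simp add: Y B_simps)
    have "B (x v) (A (Ix None) v) = 0" if "v \<in> U" for v
      using frame_gram(3)[OF that] by (simp add: A0[OF that])
    from deriv_B_const[OF open_U wU diff_x[OF wU] diff_A[OF wU] this, of h]
    have "B (deriv_along (A (Ix None)) w h) (x w) = - metric B A w $ None $ None"
      by (simp add: B_deriv_x_A[OF wU] h matrix_vector_mult_basis column_def sym[of "x w"])
    moreover have "B (deriv_along (A (Ix None)) w h) (A IxN w) = curv w * metric B A w $ None $ None"
      by (simp add: lambda2[OF wU] h matrix_vector_mult_basis column_def lambda2_None[OF wU])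
    ultimately have "d = c w * curv w"
      using 2 metric_diag_pos[OF wU, of None] by (simp add: algebra_simps)
    then show "Y (\<phi> w) = c w *\<^sub>R curv_sphere w"
      by (simp add: Y curv_sphere_def scaleR_add_right)
  qed
  obtain h where h: "coframe A u h = axis None 1" by (rule coframe_surj[OF assms(2)])
  define \<kappa> where "\<kappa> = a3 B A u None None None / metric B A u $ None $ None"
  have "c differentiable at u"
    unfolding c_def[abs_def]
    by (rule differentiableI[OF bounded_bilinear.FDERIV[OF bounded_bilinear_B dY[OF U'(2)]
          smooth_map_on_has_derivative[OF smooth_A assms(2)]]])
  then have "((\<lambda>w. c w *\<^sub>R curv_sphere w) has_derivative
      (\<lambda>h. c u *\<^sub>R deriv_along curv_sphere u h + deriv_along c u h *\<^sub>R curv_sphere u)) (at u)"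
    unfolding frechet_derivative_works
    by (rule has_derivative_scaleR[OF _ smooth_map_on_has_derivative[OF smooth_curv_sphere assms(2)]])
  then have "((\<lambda>w. Y (\<phi> w)) has_derivative
      (\<lambda>h. c u *\<^sub>R deriv_along curv_sphere u h + deriv_along c u h *\<^sub>R curv_sphere u)) (at u)"
    by (rule has_derivative_transform_within_open[OF _ U'(1,2)]) (simp add: Yc)
  \<comment> \<open>The variation of the factor \<open>c\<close> contributes only a multiple of the
    hypersphere itself, which is in the span; so the remaining multiple of \<open>x u\<close> is in
    it too.\<close>
  then have "deriv_along (\<lambda>w. Y (\<phi> w)) u h = (c u * \<kappa>) *\<^sub>R x u + (deriv_along c u h / c u) *\<^sub>R Y (\<phi> u)"
    using c[OF U'(2)]
    by (simp add: frechet_derivative_eqI deriv_curv_sphere_eigen[OF assms(2) h] \<kappa>_def Yc[OF U'(2)])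
  moreover have "(deriv_along c u h / c u) *\<^sub>R Y (\<phi> u) \<in> char_span Y (\<phi> u)"
    unfolding char_span_def by (intro span_scale span_base) simp
  ultimately have X: "(c u * \<kappa>) *\<^sub>R x u \<in> char_span Y (\<phi> u)"
    using dYspan[OF U'(2), of h] unfolding char_span_def by (metis span_add_eq2 span_add_eq)
  have "B (x u) (x u) = 0" "x u \<noteq> 0"
    using hypersurface assms(2) by (auto simp: hypersurface_def is_point_def)
  moreover have "positive_definite_on B (char_span Y (\<phi> u))"
    using fam \<phi>W[OF U'(2)] by (auto simp: sphere_family_def)
  \<comment> \<open>An isotropic vector in a positive definite subspace is zero.\<close>
  ultimately have "(c u * \<kappa>) *\<^sub>R x u = 0"
    using X unfolding positive_definite_on_def by (metis B_simps(3,4) less_irrefl mult_zero_right scaleR_zero_right)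
  then show ?thesis
    using c[OF U'(2)] \<open>x u \<noteq> 0\<close> metric_diag_pos[OF assms(2), of None] by (auto simp: \<kappa>_def)
qed

section \<open>Construction of the enveloping family when the diagonal component vanishes\<close>

lemma span_insert_range:
  assumes "linear f" "X \<in> span (insert Y (range f))"
  obtains t h where "X = t *\<^sub>R Y + f h"
proof -
  have *: "span (range f) = range f"
    using linear_subspace_image[OF assms(1) subspace_UNIV] by (simp add: span_eq_iff)
  obtain t where "X - t *\<^sub>R Y \<in> range f"
    using assms(2) unfolding span_insert * by blast
  then obtain h where "X - t *\<^sub>R Y = f h" by blast
  then show ?thesis using that[of t h] by (simp add: algebra_simps)
qed

lemma a3_zero_imp_canal:
  assumes a3: "\<And>u. u \<in> U \<Longrightarrow> a3 B A u None None None = 0"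
  shows "one_canal_for B U x (eigendirection B A s)"
  unfolding one_canal_for_def
proof
  fix u\<^sub>0 assume u0: "u\<^sub>0 \<in> U"
  \<comment> \<open>The parameters are products of \<open>curv_sphere\<close> with hyperspheres
    fixed at \<open>u\<^sub>0\<close>. They are linear in \<open>curv_sphere\<close>, so their
    derivative vanishes wherever that of \<open>curv_sphere\<close> does. At
    \<open>u\<^sub>0\<close> their derivative consists of the \<open>Some\<close> rows of the
    pencil.\<close>
  define \<phi> where "\<phi> u = (\<chi> q. B (curv_sphere u) (A (Ix (Some q)) u\<^sub>0))" for u
  \<comment> \<open>Detects the eigendirection at \<open>u\<^sub>0\<close>, where it is the kernel
    of the derivative of \<open>\<phi>\<close>.\<close>
  define l where "l h = coframe A u\<^sub>0 h $ None" for h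
  have blin: "bounded_linear (\<lambda>X. B X N)" for N
    using bounded_bilinear.bounded_linear_left[OF bounded_bilinear_B] .
  have smooth_\<phi>: "smooth_map_on U \<phi>"
    using smooth_curv_sphere unfolding smooth_map_on_def \<phi>_def[abs_def]
    by (intro allI Ck_on_vec[OF open_U] Ck_on_bounded_linear[OF open_U blin]) simp
  have d\<phi>: "deriv_along \<phi> u = (\<lambda>h. \<chi> q. B (deriv_along curv_sphere u h) (A (Ix (Some q)) u\<^sub>0))" if "u \<in> U" for u
    unfolding \<phi>_def[abs_def]
    by (rule frechet_derivative_eqI[OF has_derivative_vec[OF bounded_linear.has_derivative[OF blin
          smooth_map_on_has_derivative[OF smooth_curv_sphere that]]]])
  have lin_l: "linear l"
    using linear_coframe[OF u0] unfolding l_def[abs_def] linear_iff by simp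
  have inj0: "h = 0" if "deriv_along \<phi> u\<^sub>0 h = 0" "l h = 0" for h
  proof -
    \<comment> \<open>The \<open>Some\<close> rows vanish by assumption, the \<open>None\<close> row
      vanishes identically.\<close>
    have "(pencil u\<^sub>0 *v coframe A u\<^sub>0 h) $ i = 0" for i
      using that(1) pencil_None[OF u0]
      by (cases i) (simp_all add: d\<phi>[OF u0] B_deriv_curv_sphere(4)[OF u0] vec_eq_iff)
    then have "h \<in> eigendirection B A s u\<^sub>0" by (simp add: pencil_kernel[OF u0, symmetric] vec_eq_iff)
    then have "coframe A u\<^sub>0 h = coframe A u\<^sub>0 0"
      using that(2) by (simp add: eigendirection_eq[OF u0] l_def linear_0[OF linear_coframe[OF u0]]
          vec_eq_iff split_option_all)
    then show "h = 0" using bij_is_inj[OF bij_coframe[OF u0]] by (simp add: inj_eq)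
  qed
  have kernel: "deriv_along curv_sphere u h = 0" if u: "u \<in> U" and h: "h \<in> eigendirection B A s u" for u h
  proof -
    obtain k where k: "coframe A u k = axis None 1" by (rule coframe_surj[OF u])
    have "coframe A u h = coframe A u (coframe A u h $ None *\<^sub>R k)"
      using h by (simp add: eigendirection_eq[OF u] linear_scale[OF linear_coframe[OF u]] k vec_eq_iff
          split_option_all axis_def)
    then have "h = coframe A u h $ None *\<^sub>R k"
      by (rule injD[OF bij_is_inj[OF bij_coframe[OF u]]])
    then have "deriv_along curv_sphere u h = coframe A u h $ None *\<^sub>R deriv_along curv_sphere u k"
      using linear_scale[OF linear_curv_sphere[OF u]] by metis
    then show ?thesis by (simp add: deriv_curv_sphere_eigen[OF u k] a3[OF u])
  qed
  have ker: "\<exists>k. k \<noteq> 0 \<and> deriv_along \<phi> u k = 0 \<and> deriv_along curv_sphere u k = 0" if u: "u \<in> U" for u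
  proof -
    obtain k where k: "coframe A u k = axis None 1" by (rule coframe_surj[OF u])
    then have "k \<noteq> 0" using linear_0[OF linear_coframe[OF u]] by (auto simp: axis_eq_0_iff)
    moreover have "deriv_along curv_sphere u k = 0"
      by (rule kernel[OF u]) (simp add: eigendirection_eq[OF u] k axis_def)
    ultimately show ?thesis by (auto simp: d\<phi>[OF u] vec_eq_iff B_simps)
  qed
  obtain U' W Y where U': "open U'" "u\<^sub>0 \<in> U'" "U' \<subseteq> U" and W: "open W" "smooth_map_on W Y" "\<phi> ` U' = W"
    and surj: "\<And>u. u \<in> U' \<Longrightarrow> surj (deriv_along \<phi> u)" and Y: "\<And>u. u \<in> U' \<Longrightarrow> curv_sphere u = Y (\<phi> u)"
    using factor_through_submersion[OF open_U u0 smooth_curv_sphere smooth_\<phi> lin_l inj0 ker] by metis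
  have dY: "deriv_along curv_sphere u h = deriv_along Y (\<phi> u) (deriv_along \<phi> u h)" if u: "u \<in> U'" for u h
  proof -
    have uU: "u \<in> U" and w: "\<phi> u \<in> W" using u U' W by auto
    have "((\<lambda>u. Y (\<phi> u)) has_derivative (\<lambda>h. deriv_along Y (\<phi> u) (deriv_along \<phi> u h))) (at u)"
      by (rule has_derivative_compose[OF smooth_map_on_has_derivative[OF smooth_\<phi> uU]
            smooth_map_on_has_derivative[OF W(2) w]])
    then have "(curv_sphere has_derivative (\<lambda>h. deriv_along Y (\<phi> u) (deriv_along \<phi> u h))) (at u)"
      by (rule has_derivative_transform_within_open[OF _ U'(1) u]) (simp add: Y)
    then show ?thesis by (simp add: frechet_derivative_eqI)
  qed
  \<comment> \<open>Surjectivity of the derivative of \<open>\<phi>\<close> gives both derivatives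
    the same range, so the characteristic span can be described by
    \<open>curv_sphere\<close>.\<close>
  have range_dY: "range (deriv_along Y (\<phi> u)) = range (deriv_along curv_sphere u)" if u: "u \<in> U'" for u
    using surj[OF u] by (auto simp: dY[OF u] image_iff) (metis surjD)
  have char: "\<exists>t h. X = t *\<^sub>R curv_sphere u + deriv_along curv_sphere u h"
    if u: "u \<in> U'" and "X \<in> char_span Y (\<phi> u)" for u X
    using span_insert_range[OF linear_curv_sphere, of u X "curv_sphere u"] that U' unfolding char_span_def range_dY[OF u] Y[OF u, symmetric]
    by blast
  have posdef: "positive_definite_on B (char_span Y (\<phi> u))" if u: "u \<in> U'" for u
    unfolding positive_definite_on_def
  proof (intro ballI impI)
    have uU: "u \<in> U" using u U' by auto
    fix X assume "X \<in> char_span Y (\<phi> u)" "X \<noteq> 0"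
    then obtain t h where X: "X = t *\<^sub>R curv_sphere u + deriv_along curv_sphere u h" using char[OF u] by blast
    have BX: "B X X = t * t + B (deriv_along curv_sphere u h) (deriv_along curv_sphere u h)"
      by (simp add: X B_simps B_curv_sphere(3)[OF uU] B_deriv_curv_sphere(3)[OF uU] sym[of "curv_sphere u" "deriv_along curv_sphere u h"])
    show "B X X > 0"
    \<comment> \<open>On the kernel only the multiple of the unit vector
      \<open>curv_sphere u\<close> remains. Off the kernel the derivative has a nonzero product with
      some \<open>A (Ix i)\<close>, hence positive square.\<close>
    proof (cases "pencil u *v coframe A u h = 0")
      case True
      then have "deriv_along curv_sphere u h = 0" by (intro kernel[OF uU]) (simp add: pencil_kernel[OF uU])
      then show ?thesis using \<open>X \<noteq> 0\<close> by (auto simp: BX B_simps) (auto simp: X zero_less_mult_iff)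
    next
      case False
      then obtain i where "B (deriv_along curv_sphere u h) (A (Ix i) u) \<noteq> 0"
        by (auto simp: B_deriv_curv_sphere(4)[OF uU] vec_eq_iff)
      then have "B (deriv_along curv_sphere u h) (deriv_along curv_sphere u h) > 0"
        by (rule frame_at.tangential_B_pos[OF frame_at[OF uU], unfolded A0[OF uU], rotated 2])
           (simp_all add: B_deriv_curv_sphere[OF uU])
      then show ?thesis by (simp add: BX add_nonneg_pos)
    qed
  qed
  have dim: "dim (char_span Y (\<phi> u)) = CARD('p) + 1" if u: "u \<in> U'" for u
  proof -
    have uU: "u \<in> U" and w: "\<phi> u \<in> W" using u U' W by auto
    have lin: "linear (deriv_along Y (\<phi> u))" by (rule smooth_map_on_linear[OF W(2) w])
    \<comment> \<open>As \<open>\<phi>\<close> is linear in \<open>curv_sphere\<close>, a vector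
      killed by the derivative of \<open>Y\<close> lifts to one killed by the derivative of
      \<open>curv_sphere\<close>, and hence by that of \<open>\<phi>\<close>.\<close>
    have "k = 0" if "deriv_along Y (\<phi> u) k = 0" for k
    proof -
      obtain h where h: "k = deriv_along \<phi> u h" using surj[OF u] by (metis surjD)
      then have "deriv_along curv_sphere u h = 0" using that by (simp add: dY[OF u])
      then show "k = 0" by (simp add: h d\<phi>[OF uU] vec_eq_iff B_simps)
    qed
    then have "inj (deriv_along Y (\<phi> u))" using linear_injective_0[OF lin] by blast
    then have "dim (range (deriv_along Y (\<phi> u))) = CARD('p)"
      using dim_image_eq[OF lin, of UNIV] by (simp add: dim_UNIV)
    \<comment> \<open>A unit vector orthogonal to its own derivatives adds one dimension to their
      range.\<close>
    moreover have "Y (\<phi> u) \<notin> span (range (deriv_along Y (\<phi> u)))"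
    proof
      assume "Y (\<phi> u) \<in> span (range (deriv_along Y (\<phi> u)))"
      then have "curv_sphere u \<in> range (deriv_along curv_sphere u)"
        using linear_subspace_image[OF linear_curv_sphere[OF uU] subspace_UNIV]
        by (simp add: range_dY[OF u] Y[OF u] span_eq_iff[THEN iffD2])
      then show False using B_curv_sphere(3)[OF uU] B_deriv_curv_sphere(3)[OF uU] by (metis imageE zero_neq_one)
    qed
    ultimately show ?thesis by (simp add: char_span_def dim_insert)
  qed
  have fam: "sphere_family B W Y"
    unfolding sphere_family_def
  proof (intro conjI ballI W)
    fix w assume "w \<in> W"
    then obtain u where u: "u \<in> U'" "w = \<phi> u" using W(3) by blast
    then have "u \<in> U" using U' by auto
    show "is_hypersphere B (Y w)"
      using B_curv_sphere(3)[OF \<open>u \<in> U\<close>] by (simp add: is_hypersphere_def u Y[symmetric])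
    show "dim (char_span Y w) = CARD('p) + 1" "positive_definite_on B (char_span Y w)"
      using dim posdef u by auto
  qed
  have env: "envelope_of B U' x W Y \<phi>"
    unfolding envelope_of_def
  proof (intro conjI ballI allI smooth_map_on_subset[OF smooth_\<phi>] U' W surj)
    fix u assume u: "u \<in> U'"
    then have uU: "u \<in> U" using U' by auto
    show "tangent_to_direction B x u h (Y (\<phi> u))" for h
      using B_curv_sphere[OF uU] by (simp add: tangent_to_direction_def Y[OF u, symmetric])
    have "B (x u) Z = 0" if "Z \<in> char_span Y (\<phi> u)" for Z
      using char[OF u that] by (auto simp: B_simps B_curv_sphere[OF uU] B_deriv_curv_sphere[OF uU] sym[of "x u" "deriv_along curv_sphere u _"])
    then show "x u \<in> family_characteristic B Y (\<phi> u)"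
      using hypersurface uU by (simp add: family_characteristic_def hypersurface_def)
  qed
  have "tangent_to_direction B x u h Z"
    if u: "u \<in> U'" and h: "h \<in> eigendirection B A s u" and Z: "Z \<in> char_span Y (\<phi> u)" for u h Z
  proof -
    have uU: "u \<in> U" using u U' by auto
    obtain t k where Z': "Z = t *\<^sub>R curv_sphere u + deriv_along curv_sphere u k" using char[OF u Z] by blast
    have xk: "B (x u) (deriv_along curv_sphere u k) = 0"
      using B_deriv_curv_sphere(1)[OF uU, of k] by (simp add: sym)
    \<comment> \<open>The \<open>None\<close> row of the pencil is zero, so
      \<open>A (Ix None) u\<close> is orthogonal to every derivative of \<open>curv_sphere\<close>;
      this makes the eigendirection tangent to the characteristic circle.\<close>
    have "B (A (Ix None) u) (deriv_along curv_sphere u k) = 0"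
      using B_deriv_curv_sphere(4)[OF uU, of k None] pencil_None[OF uU] by (simp add: sym)
    then have "B (deriv_along x u h) (deriv_along curv_sphere u k) = 0"
      using h by (simp add: deriv_x_expand[OF uU, of h] B_simps B_sum_left xk sum_option eigendirection_eq[OF uU])
    then show ?thesis
      by (simp add: tangent_to_direction_def Z' B_simps B_curv_sphere[OF uU] xk)
  qed
  then show "\<exists>U' W Y \<phi>. open U' \<and> u\<^sub>0 \<in> U' \<and> U' \<subseteq> U \<and> sphere_family B W Y \<and> envelope_of B U' x W Y \<phi> \<and>
      (\<forall>u\<in>U'. \<forall>h\<in>eigendirection B A s u. \<forall>Z\<in>char_span Y (\<phi> u). tangent_to_direction B x u h Z)"
    using U' fam env by blast
qed

end

theorem theorem2:
  fixes n :: nat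
    and B :: "'v::euclidean_space \<Rightarrow> 'v \<Rightarrow> real"
    and U :: "(real^('p::finite option)) set"
    and x :: "real^('p option) \<Rightarrow> 'v"
    and A :: "('p option, 'v) frame_field"
    and s\<^sub>1 :: "real^('p option) \<Rightarrow> real"
  assumes "n \<ge> 3" and "CARD('p) = n - 2" and "DIM('v) = n + 2"
    and "has_signature B (n + 1) 1"
    and "hypersurface B U x"
    and "conformal_frame B U x A"
    and "\<forall>u\<in>U. det (a2 B A u) \<noteq> 0"
    and "\<forall>u\<in>U. simple_eigenvalue (burali_forti B A u) (s\<^sub>1 u)"
    and "adapted_frame B U A s\<^sub>1"
  shows "one_canal_for B U x (eigendirection B A s\<^sub>1) \<longleftrightarrow>
         (\<forall>u\<in>U. a3 B A u None None None = 0)"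
proof -
  \<comment> \<open>The dimension condition reads \<open>n + 2 = (n - 1) + 3\<close>, as
    \<open>'p option\<close> has \<open>n - 1\<close> elements.\<close>
  interpret adapted_hypersurface B U x A s\<^sub>1
    using assms by unfold_locales (auto simp: has_signature_def)
  show ?thesis using canal_imp_a3_zero a3_zero_imp_canal by blast
qed

end
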